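(* Let $m_0=\sum_{i=1}^N a_{0,i}\delta_{x_{0,i}}$ be a discrete measure on $\mathbb{T}$ (with $a_{0,i}\in\mathbb{R}\setminus\{0\}$ and pairwise distinct $x_{0,i}$), and $y_0=\Phi m_0$. Consider the problem $$(V)\qquad p_V=\operatorname*{argmin}_{p\in L^2(\mathbb{T})}\|p\|_2\quad\text{subject to}\quad(\Phi^*p)(x_{0,i})=\operatorname{sign}(a_{0,i}),\ (\Phi^*p)'(x_{0,i})=0\quad\text{for all }1\le i\le N,$$ and, when it is feasible, let $\eta_V=\Phi^*p_V$. The following assertions hold. 1. Problem $(V)$ is feasible and $\|\eta_V\|_\infty\le1$ if and only if the Source Condition holds for $m_0$ and $\eta_V=\eta_0$. 2. If Problem $(V)$ is feasible and $\Gamma_{x_0}$ has full rank, i.e. $\Gamma_{x_0}^*\Gamma_{x_0}\in\mathbb{R}^{2N\times2N}$ is invertible, then $$\eta_V=\Phi^*\Gamma_{x_0}^{+,*}\begin{pmatrix}\operatorname{sign}(a_0)\\0\end{pmatrix},\qquad\text{where }\Gamma_{x_0}^{+,*}=\Gamma_{x_0}(\Gamma_{x_0}^*\Gamma_{x_0})^{-1}.$$ 3. If $\Gamma_{x_0}$ has full rank, then $m_0$ satisfies the Non Degenerate Source Condition if and only if Problem $(V)$ is feasible and $$\forall s\in\mathbb{T}\setminus\{x_{0,1},\dots,x_{0,N}\},\ |\eta_V(s)|<1,\qquad\forall i\in\{1,\dots,N\},\ \eta_V''(x_{0,i})\neq0.$$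
   Context: $\mathbb{T}=\mathbb{R}/\mathbb{Z}$. $\mathcal{M}(\mathbb{T})$ is the space of real Radon measures on $\mathbb{T}$ and $\|m\|_{TV}=\sup\{\int\psi\,dm:\psi\in C(\mathbb{T}),\|\psi\|_\infty\le1\}$. Fix a real-valued $\varphi\in C^2(\mathbb{T})$ and let $\Phi:\mathcal{M}(\mathbb{T})\to L^2(\mathbb{T})$, $(\Phi m)(t)=\int_{\mathbb{T}}\varphi(x-t)\,dm(x)$, with adjoint $\Phi^*:L^2(\mathbb{T})\to C(\mathbb{T})$, $(\Phi^*p)(t)=\int_{\mathbb{T}}\varphi(t-x)p(x)\,dx$. For $x\in\mathbb{T}^N$, $\Gamma_x:\mathbb{R}^N\times\mathbb{R}^N\to L^2(\mathbb{T})$ is $\Gamma_x(u,v)=\sum_{i=1}^N u_i\varphi(x_i-\cdot)+\sum_{i=1}^N v_i\varphi'(x_i-\cdot)$; full rank means injective; $\Gamma_x^*$ is its adjoint. $a_0=(a_{0,i})_i$, $x_0=(x_{0,i})_i$, and $\operatorname{sign}(a_0)=(\operatorname{sign}(a_{0,i}))_i\in\mathbb{R}^N$. $\partial\|m\|_{TV}=\{\eta\in C(\mathbb{T}):\|\eta\|_\infty\le1,\ \int\eta\,dm=\|m\|_{TV}\}$. Source Condition for $m_0$: there exists $p\in L^2(\mathbb{T})$ with $\Phi^*p\in\partial\|m_0\|_{TV}$. $\mathcal{D}_0(y_0)$ is the problem $\sup\{\langle y_0,p\rangle:p\in L^2(\mathbb{T}),\ \|\Phi^*p\|_\infty\le1\}$.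 When it has a solution (in particular under the Source Condition), the minimal norm certificate is $\eta_0=\Phi^*p_0$, where $p_0$ is the solution of $\mathcal{D}_0(y_0)$ of minimal $L^2$ norm. Non Degenerate Source Condition for $m_0$: the Source Condition holds, and $\eta_0$ satisfies $|\eta_0(s)|<1$ for all $s\in\mathbb{T}\setminus\{x_{0,1},\dots,x_{0,N}\}$ and $\eta_0''(x_{0,i})\neq0$ for all $i\in\{1,\dots,N\}$. *)

theory Defs
  imports "HOL-Analysis.Analysis"
begin

section \<open>The torus\<close>

quotient_type circle = real / "\<lambda>x y :: real. x - y \<in> \<int>"
  morphisms rep_circle circle_of
proof (rule equivpI)
  show "reflp (\<lambda>x y :: real. x - y \<in> \<int>)"
    by (auto intro!: reflpI)
  show "symp (\<lambda>x y :: real. x - y \<in> \<int>)"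
    by (rule sympI) (metis Ints_minus minus_diff_eq)
  show "transp (\<lambda>x y :: real. x - y \<in> \<int>)"
  proof (rule transpI)
    fix x y z :: real
    assume "x - y \<in> \<int>" "y - z \<in> \<int>"
    then have "(x - y) + (y - z) \<in> \<int>" by (rule Ints_add)
    then show "x - z \<in> \<int>" by simp
  qed
qed

instantiation circle :: ab_group_add
begin

lift_definition zero_circle :: circle is "0 :: real" .

lift_definition plus_circle :: "circle \<Rightarrow> circle \<Rightarrow> circle" is "(+) :: real \<Rightarrow> _"
  by (metis Ints_add add_diff_add)

lift_definition minus_circle :: "circle \<Rightarrow> circle \<Rightarrow> circle" is "(-) :: real \<Rightarrow> _"
proof -
  fix a b c d :: real
  assume "a - b \<in> \<int>" "c - d \<in> \<int>"
  then have "(a - b) - (c - d) \<in> \<int>" by (rule Ints_diff)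
  then show "a - c - (b - d) \<in> \<int>" by (simp add: algebra_simps)
qed

lift_definition uminus_circle :: "circle \<Rightarrow> circle" is "uminus :: real \<Rightarrow> _"
  by (metis Ints_minus minus_diff_minus)

instance
  by standard (transfer; simp)+

end

lifting_forget circle.lifting

instantiation circle :: topological_space
begin

text \<open>The quotient topology.\<close>

definition open_circle :: "circle set \<Rightarrow> bool"
  where "open_circle U \<longleftrightarrow> open (circle_of -` U)"

instance
  by standard (auto simp: open_circle_def vimage_Union)

end

lemma continuous_circle_of: "continuous_on UNIV circle_of"
  unfolding continuous_on_open_vimage[OF open_UNIV] by (auto simp: open_circle_def)

lemma closed_circle_singleton: "closed {t :: circle}"
proof -
  have eq: "circle_of -` (- {t}) = - ((\<lambda>n. rep_circle t + n) ` \<int>)"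
  proof -
    have "circle_of s = t \<longleftrightarrow> s - rep_circle t \<in> \<int>" for s
      by (metis Quotient3_circle Quotient3_abs_rep circle.abs_eq_iff)
    moreover have "s - rep_circle t \<in> \<int> \<longleftrightarrow> s \<in> (\<lambda>n. rep_circle t + n) ` \<int>" for s
      by (auto simp: image_iff intro!: bexI[of _ "s - rep_circle t"])
    ultimately show ?thesis by blast
  qed
  have "closed ((\<lambda>n. rep_circle t + n) ` (\<int>::real set))"
    by (intro closed_translation closed_Ints)
  then show ?thesis unfolding closed_def open_circle_def eq by (simp add: open_Compl)
qed

lemma borel_circle_singleton [measurable,simp]: "{t::circle} \<in> sets borel" by (simp add: closed_circle_singleton)

definition circle_measure :: "circle measure"
  where "circle_measure = distr (restrict_space lborel {0..<1}) borel circle_of"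

lemma measurable_circle_of: "circle_of \<in> borel_measurable (restrict_space lborel {0..<1})"
proof -
  have "circle_of \<in> borel_measurable borel" by (rule borel_measurable_continuous_onI[OF continuous_circle_of])
  then have "circle_of \<in> borel_measurable lborel" by simp
  then show ?thesis by (rule measurable_restrict_space1)
qed

lemma emeasure_circle_measure_UNIV: "emeasure circle_measure UNIV = 1"
proof -
  have "emeasure circle_measure UNIV = emeasure (restrict_space lborel {0..<1::real}) {0..<1}"
    unfolding circle_measure_def
    by (subst emeasure_distr[OF measurable_circle_of]) (auto simp: space_restrict_space)
  also have "\<dots> = 1" by (subst emeasure_restrict_space) auto
  finally show ?thesis .
qed

text \<open>The derivative of the 1-periodic lift, expressed through the group structure.\<close>

definition circle_deriv :: "(circle \<Rightarrow> real) \<Rightarrow> circle \<Rightarrow> real"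
  where "circle_deriv f t = deriv (\<lambda>s. f (t + circle_of s)) 0"

definition C1 :: "(circle \<Rightarrow> real) \<Rightarrow> bool"
  where "C1 f \<longleftrightarrow> (\<forall>t. (\<lambda>s. f (t + circle_of s)) differentiable (at 0))
    \<and> continuous_on UNIV (circle_deriv f)"

definition C2 :: "(circle \<Rightarrow> real) \<Rightarrow> bool"
  where "C2 f \<longleftrightarrow> C1 f \<and> C1 (circle_deriv f)"

definition sup_norm :: "(circle \<Rightarrow> real) \<Rightarrow> real"
  where "sup_norm f = (SUP t. \<bar>f t\<bar>)"


section \<open>The space L2 of the torus\<close>

definition square_integrable :: "(circle \<Rightarrow> real) \<Rightarrow> bool"
  where "square_integrable f \<longleftrightarrow>
    f \<in> borel_measurable borel \<and> integrable circle_measure (\<lambda>t. (f t)\<^sup>2)"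

definition l2_eq :: "(circle \<Rightarrow> real) \<Rightarrow> (circle \<Rightarrow> real) \<Rightarrow> bool"
  where "l2_eq f g \<longleftrightarrow>
    square_integrable f \<and> square_integrable g \<and> (AE t in circle_measure. f t = g t)"

lemma sets_circle_measure [simp, measurable_cong]: "sets circle_measure = sets borel"
  by (simp add: circle_measure_def)

lemma square_integrable_mult:
  assumes "square_integrable f" "square_integrable g"
  shows "integrable circle_measure (\<lambda>t. f t * g t)"
proof (rule Bochner_Integration.integrable_bound)
  show "integrable circle_measure (\<lambda>t. (f t)\<^sup>2 + (g t)\<^sup>2)"
    using assms by (simp add: square_integrable_def)
  have [measurable]: "f \<in> borel_measurable borel" "g \<in> borel_measurable borel"
    using assms by (simp_all add: square_integrable_def)
  show "(\<lambda>t. f t * g t) \<in> borel_measurable circle_measure"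
    by measurable
  have "\<bar>a * b\<bar> \<le> \<bar>a\<^sup>2 + b\<^sup>2\<bar>" for a b :: real
  proof -
    have "0 \<le> (\<bar>a\<bar> - \<bar>b\<bar>)\<^sup>2" "0 \<le> \<bar>a * b\<bar>" by simp_all
    then have "2 * \<bar>a * b\<bar> \<le> a\<^sup>2 + b\<^sup>2" "0 \<le> \<bar>a * b\<bar>"
      by (simp_all add: power2_diff abs_mult)
    then show ?thesis by linarith
  qed
  then show "AE t in circle_measure. norm (f t * g t) \<le> norm ((f t)\<^sup>2 + (g t)\<^sup>2)"
    by simp
qed

lemma square_integrable_add:
  assumes "square_integrable f" "square_integrable g"
  shows "square_integrable (\<lambda>t. f t + g t)"
  using assms square_integrable_mult[OF assms]
  by (auto simp: square_integrable_def power2_sum mult.assoc)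

lemma square_integrable_scaleR:
  assumes "square_integrable f"
  shows "square_integrable (\<lambda>t. c * f t)"
  using assms by (auto simp: square_integrable_def power_mult_distrib)

lemma square_integrable_zero: "square_integrable (\<lambda>t. 0)"
  by (simp add: square_integrable_def)

lemma square_integrable_uminus:
  assumes "square_integrable f"
  shows "square_integrable (\<lambda>t. - f t)"
  using square_integrable_scaleR[OF assms, of "-1"] by simp

lemma square_integrable_diff:
  assumes "square_integrable f" "square_integrable g"
  shows "square_integrable (\<lambda>t. f t - g t)"
  using square_integrable_add[OF assms(1) square_integrable_uminus[OF assms(2)]] by simp

lemma continuous_imp_square_integrable: assumes "continuous_on UNIV f" shows "square_integrable f"
proof -
  have "range f = (f \<circ> circle_of) ` {0..1}"
  proof -
    have "\<exists>s\<in>{0..1}. t = circle_of s" for t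
    proof -
      obtain s where "t = circle_of s" by (metis Quotient3_abs_rep Quotient3_circle)
      moreover have "circle_of s = circle_of (frac s)"
        by (simp add: circle.abs_eq_iff frac_def)
      ultimately show ?thesis using frac_lt_1[of s] by (intro bexI[of _ "frac s"]) (auto simp: less_imp_le)
    qed
    then show ?thesis by (auto simp: image_iff) metis
  qed
  moreover have "compact ((f \<circ> circle_of) ` {0..1})"
    using assms continuous_circle_of by (intro compact_continuous_image continuous_on_compose) (auto intro: continuous_on_subset)
  ultimately have "bounded (range f)" by (simp add: compact_imp_bounded)
  then obtain B where B: "\<And>t. \<bar>f t\<bar> \<le> B" by (auto simp: bounded_iff)
  interpret finite_measure circle_measure
    by (rule finite_measureI) (use emeasure_circle_measure_UNIV in \<open>simp add: circle_measure_def\<close>)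
  have "f \<in> borel_measurable borel" using assms by (rule borel_measurable_continuous_onI)
  then show ?thesis unfolding square_integrable_def
  proof (intro conjI integrable_const_bound[where B="B^2"])
    have "(f t)\<^sup>2 \<le> B\<^sup>2" for t
      using B[of t] by (metis abs_ge_zero power2_abs power_mono)
    then show "AE t in circle_measure. norm ((f t)\<^sup>2) \<le> B\<^sup>2" by simp
  qed auto
qed

quotient_type l2 = "circle \<Rightarrow> real" / partial: l2_eq
  morphisms l2_fun abs_l2
proof (rule part_equivpI)
  show "\<exists>f. l2_eq f f"
    by (rule exI[of _ "\<lambda>t. 0"]) (simp add: l2_eq_def square_integrable_zero)
  show "symp l2_eq"
    by (rule sympI) (auto simp: l2_eq_def elim: AE_mp)
  show "transp l2_eq"
    by (rule transpI) (auto simp: l2_eq_def elim!: AE_mp)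
qed

instantiation l2 :: real_inner
begin

lift_definition zero_l2 :: l2 is "\<lambda>t. 0"
  by (simp add: l2_eq_def square_integrable_zero)

lift_definition plus_l2 :: "l2 \<Rightarrow> l2 \<Rightarrow> l2" is "\<lambda>f g t. f t + g t"
  by (auto simp: l2_eq_def square_integrable_add)

lift_definition minus_l2 :: "l2 \<Rightarrow> l2 \<Rightarrow> l2" is "\<lambda>f g t. f t - g t"
  by (auto simp: l2_eq_def square_integrable_diff)

lift_definition uminus_l2 :: "l2 \<Rightarrow> l2" is "\<lambda>f t. - f t"
  by (auto simp: l2_eq_def square_integrable_uminus)

lift_definition scaleR_l2 :: "real \<Rightarrow> l2 \<Rightarrow> l2" is "\<lambda>c f t. c * f t"
  by (auto simp: l2_eq_def square_integrable_scaleR)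

lift_definition inner_l2 :: "l2 \<Rightarrow> l2 \<Rightarrow> real"
  is "\<lambda>f g. \<integral>t. f t * g t \<partial>circle_measure"
proof -
  fix f f' g g'
  assume *: "l2_eq f f'" "l2_eq g g'"
  then have [measurable]: "f \<in> borel_measurable borel" "f' \<in> borel_measurable borel"
      "g \<in> borel_measurable borel" "g' \<in> borel_measurable borel"
    by (simp_all add: l2_eq_def square_integrable_def)
  show "(\<integral>t. f t * g t \<partial>circle_measure) = (\<integral>t. f' t * g' t \<partial>circle_measure)"
    using * by (intro integral_cong_AE) (auto simp: l2_eq_def)
qed

definition norm_l2 :: "l2 \<Rightarrow> real" where "norm_l2 f = sqrt (inner f f)"
definition dist_l2 :: "l2 \<Rightarrow> l2 \<Rightarrow> real" where "dist_l2 f g = norm (f - g)"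
definition sgn_l2 :: "l2 \<Rightarrow> l2" where "sgn_l2 f = scaleR (inverse (norm f)) f"
definition uniformity_l2 :: "(l2 \<times> l2) filter"
  where "uniformity_l2 = (INF e\<in>{0<..}. principal {(f, g). dist f g < e})"
definition open_l2 :: "l2 set \<Rightarrow> bool"
  where "open_l2 U \<longleftrightarrow> (\<forall>f\<in>U. \<forall>\<^sub>F (f', g) in uniformity. f' = f \<longrightarrow> g \<in> U)"

instance
proof
  fix a b :: real and f g h :: l2
  show "f + g + h = f + (g + h)"
    by transfer (auto simp: l2_eq_def add.assoc intro!: square_integrable_add)
  show "f + g = g + f"
    by transfer (auto simp: l2_eq_def add.commute intro!: square_integrable_add)
  show "0 + f = f"
    by transfer (auto simp: l2_eq_def)
  show "- f + f = 0"
    by transfer (auto simp: l2_eq_def square_integrable_zero)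
  show "f - g = f + - g"
    by transfer (auto simp: l2_eq_def intro!: square_integrable_diff)
  show "a *\<^sub>R (f + g) = a *\<^sub>R f + a *\<^sub>R g"
    by transfer (auto simp: l2_eq_def distrib_left
        intro!: square_integrable_add square_integrable_scaleR)
  show "(a + b) *\<^sub>R f = a *\<^sub>R f + b *\<^sub>R f"
    by transfer (auto simp: l2_eq_def distrib_right
        intro!: square_integrable_add square_integrable_scaleR)
  show "a *\<^sub>R b *\<^sub>R f = (a * b) *\<^sub>R f"
    by transfer (auto simp: l2_eq_def mult.assoc intro!: square_integrable_scaleR)
  show "1 *\<^sub>R f = f"
    by transfer (auto simp: l2_eq_def)
  show "inner f g = inner g f"
    by transfer (simp add: mult.commute)
  show "inner (f + g) h = inner f h + inner g h"
    by transfer (simp add: l2_eq_def distrib_right square_integrable_mult)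
  show "inner (a *\<^sub>R f) g = a * inner f g"
    by transfer (simp add: mult.assoc)
  show "0 \<le> inner f f"
    by transfer simp
  show "(inner f f = 0) = (f = 0)"
  proof transfer
    fix f assume "l2_eq f f"
    then have f: "square_integrable f" by (simp add: l2_eq_def)
    have "((\<integral>t. f t * f t \<partial>circle_measure) = 0) = (AE t in circle_measure. f t * f t = 0)"
      using square_integrable_mult[OF f f] by (intro integral_nonneg_eq_0_iff_AE) auto
    then show "((\<integral>t. f t * f t \<partial>circle_measure) = 0) = l2_eq f (\<lambda>t. 0)"
      using f by (simp add: l2_eq_def square_integrable_zero)
  qed
  show "norm f = sqrt (inner f f)" by (rule norm_l2_def)
  show "dist f g = norm (f - g)" by (rule dist_l2_def)
  show "sgn f = scaleR (inverse (norm f)) f" by (rule sgn_l2_def)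
next
  show "uniformity = (INF e\<in>{0<..}. principal {(f :: l2, g). dist f g < e})"
    by (rule uniformity_l2_def)
next
  fix U :: "l2 set"
  show "open U = (\<forall>f\<in>U. \<forall>\<^sub>F (f', g) in uniformity. f' = f \<longrightarrow> g \<in> U)"
    by (rule open_l2_def)
qed

end


section \<open>Real Radon measures on the torus\<close>

text \<open>On a compact metrizable space every finite signed Borel measure is regular, hence Radon.
  The first condition makes the representing set function unique.\<close>

typedef radon = "{m :: circle set \<Rightarrow> real.
    (\<forall>A. A \<notin> sets borel \<longrightarrow> m A = 0) \<and>
    (\<forall>A :: nat \<Rightarrow> circle set. range A \<subseteq> sets borel \<longrightarrow> disjoint_family A \<longrightarrow>
      (\<lambda>n. m (A n)) sums m (\<Union>n. A n))}"
  morphisms radon_meas Abs_radon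
  by (rule exI[of _ "\<lambda>A. 0"]) simp

setup_lifting type_definition_radon

instantiation radon :: real_vector
begin

lift_definition zero_radon :: radon is "\<lambda>A. 0" by simp

lift_definition plus_radon :: "radon \<Rightarrow> radon \<Rightarrow> radon" is "\<lambda>m n A. m A + n A"
  by (auto intro: sums_add)

lift_definition minus_radon :: "radon \<Rightarrow> radon \<Rightarrow> radon" is "\<lambda>m n A. m A - n A"
  by (auto intro: sums_diff)

lift_definition uminus_radon :: "radon \<Rightarrow> radon" is "\<lambda>m A. - m A"
  by (auto intro: sums_minus)

lift_definition scaleR_radon :: "real \<Rightarrow> radon \<Rightarrow> radon" is "\<lambda>c m A. c * m A"
  by (auto intro: sums_mult)

instance
  by standard (transfer; simp add: algebra_simps)+

end

lift_definition dirac :: "circle \<Rightarrow> radon"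
  is "\<lambda>x A. if A \<in> sets borel then indicator A x else 0"
proof (intro conjI allI impI)
  fix x :: circle and A :: "nat \<Rightarrow> circle set"
  assume A: "range A \<subseteq> sets borel" "disjoint_family A"
  have "(\<lambda>n. indicator (A n) x :: real) sums indicator (\<Union>n. A n) x"
    using A(2) by (intro indicator_sums) (auto simp: disjoint_family_on_def)
  moreover have "(\<Union>n. A n) \<in> sets borel" using A(1) by blast
  ultimately show "(\<lambda>n. if A n \<in> sets borel then indicator (A n) x else 0) sums
      (if (\<Union>n. A n) \<in> sets borel then indicator (\<Union>n. A n) x else 0 :: real)"
    using A(1) by (simp add: range_subsetD)
qed simp

text \<open>Integration against \<open>m\<close> uses its Jordan decomposition
  \<open>pos_part m - pos_part (- m)\<close>.\<close>

definition pos_part :: "radon \<Rightarrow> circle measure"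
  where "pos_part m = measure_of UNIV (sets borel)
    (\<lambda>A. SUP B\<in>{B \<in> sets borel. B \<subseteq> A}. ennreal (radon_meas m B))"

definition radon_integral :: "radon \<Rightarrow> (circle \<Rightarrow> real) \<Rightarrow> real"
  where "radon_integral m f =
    (\<integral>x. f x \<partial>pos_part m) - (\<integral>x. f x \<partial>pos_part (- m))"

lemma radon_meas_sum: "finite I \<Longrightarrow> radon_meas (\<Sum>i\<in>I. f i) A = (\<Sum>i\<in>I. radon_meas (f i) A)"
  by (induction I rule: finite_induct) (auto simp: zero_radon.rep_eq plus_radon.rep_eq)

lemma pos_part_discrete: fixes a :: "real^'n" and x :: "circle^'n" assumes "inj (($) x)"
  shows "pos_part (\<Sum>i\<in>UNIV. (a $ i) *\<^sub>R dirac (x $ i)) =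
    distr (point_measure UNIV (\<lambda>i. ennreal (max 0 (a$i)))) borel (($) x)" (is "pos_part ?m = ?D")
proof -
  have m: "radon_meas ?m A = (\<Sum>i\<in>UNIV. a $ i * indicator A (x $ i))" if "A \<in> sets borel" for A
    using that by (simp add: radon_meas_sum scaleR_radon.rep_eq dirac.rep_eq)
  have "(SUP B\<in>{B \<in> sets borel. B \<subseteq> A}. ennreal (radon_meas ?m B)) = emeasure ?D A"
    if A: "A \<in> sets borel" for A
  proof -
    have "emeasure ?D A = (\<Sum>i\<in>(($) x) -` A. ennreal (max 0 (a$i)))"
      using A by (subst emeasure_distr) (auto simp: space_point_measure sets_point_measure measurable_def emeasure_point_measure_finite)
    also have "\<dots> = ennreal (\<Sum>i\<in>(($) x) -` A. max 0 (a$i))" by (simp add: sum_ennreal)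
    also have "\<dots> = ennreal (\<Sum>i\<in>UNIV. max 0 (a$i) * indicator A (x$i))"
      by (intro arg_cong[where f=ennreal] sum.mono_neutral_cong_left) (auto split: split_indicator)
    finally have E: "emeasure ?D A = ennreal (\<Sum>i\<in>UNIV. max 0 (a$i) * indicator A (x$i))" .
    show ?thesis
    proof (rule antisym)
      show "(SUP B\<in>{B \<in> sets borel. B \<subseteq> A}. ennreal (radon_meas ?m B)) \<le> emeasure ?D A"
        unfolding E
      proof (rule SUP_least)
        fix B assume "B \<in> {B \<in> sets borel. B \<subseteq> A}"
        then have B: "B \<in> sets borel" "B \<subseteq> A" by auto
        show "ennreal (radon_meas ?m B) \<le> ennreal (\<Sum>i\<in>UNIV. max 0 (a$i) * indicator A (x$i))"
          unfolding m[OF B(1)] by (rule ennreal_leI, rule sum_mono) (use B(2) in \<open>auto simp: indicator_def\<close>)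
      qed
      let ?B = "A \<inter> (\<Union>i\<in>{i. a $ i > 0}. {x $ i})"
      have B: "?B \<in> sets borel" by (intro sets.Int A sets.finite_UN) auto
      have "radon_meas ?m ?B = (\<Sum>i\<in>UNIV. max 0 (a$i) * indicator A (x$i))"
        unfolding m[OF B]
        by (intro sum.cong refl) (auto simp: indicator_def max_def inj_eq[OF assms])
      then show "emeasure ?D A \<le> (SUP B\<in>{B \<in> sets borel. B \<subseteq> A}. ennreal (radon_meas ?m B))"
        unfolding E using B by (intro SUP_upper2[of ?B]) auto
    qed
  qed
  then have "pos_part ?m = measure_of (space ?D) (sets ?D) (emeasure ?D)"
    unfolding pos_part_def space_distr space_borel sets_distr
    by (intro measure_of_eq) (auto simp: sets.sigma_sets_eq[of borel, simplified])
  then show ?thesis by (simp only: measure_of_of_measure)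
qed

lemma radon_integral_discrete: fixes a :: "real^'n" and x :: "circle^'n" assumes "inj (($) x)"
  and f: "f \<in> borel_measurable borel"
  shows "radon_integral (\<Sum>i\<in>UNIV. (a $ i) *\<^sub>R dirac (x $ i)) f = (\<Sum>i\<in>UNIV. a $ i * f (x $ i))"
proof -
  have n: "- (\<Sum>i\<in>UNIV. (a $ i) *\<^sub>R dirac (x $ i)) = (\<Sum>i\<in>UNIV. ((-a) $ i) *\<^sub>R dirac (x $ i))"
    by (simp add: sum_negf)
  have *: "integral\<^sup>L (distr (point_measure UNIV (\<lambda>i. ennreal (max 0 (b$i)))) borel (($) x)) f = (\<Sum>i\<in>UNIV. max 0 (b $ i) * f (x $ i))" for b :: "real^'n"
    using f by (subst integral_distr) (auto simp: measurable_def space_point_measure sets_point_measure lebesgue_integral_point_measure_finite)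
  show ?thesis
    unfolding radon_integral_def n pos_part_discrete[OF assms(1)] *
    by (auto simp: sum_subtractf[symmetric] max_def intro!: sum.cong)
qed

definition tv_norm :: "radon \<Rightarrow> real"
  where "tv_norm m =
    Sup {radon_integral m f | f. continuous_on UNIV f \<and> sup_norm f \<le> 1}"

definition tv_subdiff :: "radon \<Rightarrow> (circle \<Rightarrow> real) set"
  where "tv_subdiff m =
    {f. continuous_on UNIV f \<and> sup_norm f \<le> 1 \<and> radon_integral m f = tv_norm m}"


section \<open>The operators\<close>

text \<open>\<open>abs_l2\<close> is applied below to continuous functions only; these are square integrable by
  \<open>continuous_imp_square_integrable\<close>.\<close>

definition Phi :: "(circle \<Rightarrow> real) \<Rightarrow> radon \<Rightarrow> l2"
  where "Phi \<phi> m = abs_l2 (\<lambda>t. radon_integral m (\<lambda>x. \<phi> (x - t)))"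

definition Phi_adj :: "(circle \<Rightarrow> real) \<Rightarrow> l2 \<Rightarrow> circle \<Rightarrow> real"
  where "Phi_adj \<phi> p t = (\<integral>x. \<phi> (t - x) * l2_fun p x \<partial>circle_measure)"

definition Gamma_op :: "(circle \<Rightarrow> real) \<Rightarrow> circle ^ 'n \<Rightarrow> (real ^ 'n) \<times> (real ^ 'n) \<Rightarrow> l2"
  where "Gamma_op \<phi> x = (\<lambda>(u, v).
    (\<Sum>i\<in>UNIV. (u $ i) *\<^sub>R abs_l2 (\<lambda>t. \<phi> (x $ i - t))) +
    (\<Sum>i\<in>UNIV. (v $ i) *\<^sub>R abs_l2 (\<lambda>t. circle_deriv \<phi> (x $ i - t))))"

definition Gamma_pinv_adj ::
    "(circle \<Rightarrow> real) \<Rightarrow> circle ^ 'n \<Rightarrow> (real ^ 'n) \<times> (real ^ 'n) \<Rightarrow> l2"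
  where "Gamma_pinv_adj \<phi> x =
    Gamma_op \<phi> x \<circ> inv (adjoint (Gamma_op \<phi> x) \<circ> Gamma_op \<phi> x)"

lemma linear_Gamma_op: "linear (Gamma_op \<phi> x)"
  by (rule linearI) (auto simp: Gamma_op_def split_beta scaleR_add_left scaleR_add_right sum.distrib scaleR_sum_right)

lemma inner_adjoint: fixes f :: "'a::euclidean_space \<Rightarrow> 'b::real_inner" assumes "linear f"
  shows "inner (f x) y = inner x (adjoint f y)"
proof -
  have 1: "inner (f x) y = inner x (\<Sum>b\<in>Basis. inner (f b) y *\<^sub>R b)" for x y
  proof -
    have "f x = (\<Sum>b\<in>Basis. inner x b *\<^sub>R f b)"
      by (metis (mono_tags, lifting) assms euclidean_representation linear_sum linear_scale sum.cong)
    then show ?thesis by (simp add: inner_sum_left inner_sum_right mult.commute)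
  qed
  then have "adjoint f = (\<lambda>y. \<Sum>b\<in>Basis. inner (f b) y *\<^sub>R b)" by (intro adjoint_unique) blast
  then show ?thesis using 1[of x y] by metis
qed

lemma inj_Gamma_op_iff: "inj (Gamma_op \<phi> x) \<longleftrightarrow> bij (adjoint (Gamma_op \<phi> x) \<circ> Gamma_op \<phi> x)"
proof
  let ?G = "Gamma_op \<phi> x"
  assume i: "inj ?G"
  have lin: "linear (adjoint ?G \<circ> ?G)"
  proof (rule linearI)
    fix u v show "(adjoint ?G \<circ> ?G) (u + v) = (adjoint ?G \<circ> ?G) u + (adjoint ?G \<circ> ?G) v"
      by (simp add: vector_eq_ldot[symmetric] inner_add_right inner_adjoint[OF linear_Gamma_op, symmetric] linear_add[OF linear_Gamma_op])
  next
    fix c u show "(adjoint ?G \<circ> ?G) (c *\<^sub>R u) = c *\<^sub>R (adjoint ?G \<circ> ?G) u"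
      by (simp add: vector_eq_ldot[symmetric] inner_adjoint[OF linear_Gamma_op, symmetric] linear_scale[OF linear_Gamma_op])
  qed
  have "inj (adjoint ?G \<circ> ?G)"
    unfolding linear_injective_0[OF lin]
  proof (intro allI impI)
    fix u assume "(adjoint ?G \<circ> ?G) u = 0"
    then have "inner (?G u) (?G u) = 0" by (simp add: inner_adjoint[OF linear_Gamma_op])
    then show "u = 0" using i linear_Gamma_op linear_injective_0 by (metis inner_eq_zero_iff)
  qed
  then show "bij (adjoint ?G \<circ> ?G)" using lin linear_injective_imp_surjective by (metis bij_def)
next
  assume "bij (adjoint (Gamma_op \<phi> x) \<circ> Gamma_op \<phi> x)"
  then show "inj (Gamma_op \<phi> x)" by (metis bij_is_inj inj_on_imageI2)
qed


section \<open>Certificates\<close>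

definition source_condition :: "(circle \<Rightarrow> real) \<Rightarrow> radon \<Rightarrow> bool"
  where "source_condition \<phi> m \<longleftrightarrow> (\<exists>p. Phi_adj \<phi> p \<in> tv_subdiff m)"

definition dual_solution :: "(circle \<Rightarrow> real) \<Rightarrow> l2 \<Rightarrow> l2 \<Rightarrow> bool"
  where "dual_solution \<phi> y p \<longleftrightarrow>
    is_arg_max (\<lambda>q. inner y q) (\<lambda>q. sup_norm (Phi_adj \<phi> q) \<le> 1) p"

text \<open>\<open>eta_0\<close> and \<open>eta_V\<close> below are meaningful only if the respective problem has a solution;
  the minimal norm solution is then unique by strict convexity.\<close>

definition eta_0 :: "(circle \<Rightarrow> real) \<Rightarrow> l2 \<Rightarrow> circle \<Rightarrow> real"
  where "eta_0 \<phi> y = Phi_adj \<phi> (arg_min norm (dual_solution \<phi> y))"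

definition nondegenerate_source_condition ::
    "(circle \<Rightarrow> real) \<Rightarrow> radon \<Rightarrow> circle ^ 'n \<Rightarrow> bool"
  where "nondegenerate_source_condition \<phi> m x \<longleftrightarrow>
    source_condition \<phi> m \<and>
    (\<forall>s. s \<notin> range (($) x) \<longrightarrow> \<bar>eta_0 \<phi> (Phi \<phi> m) s\<bar> < 1) \<and>
    (\<forall>i. circle_deriv (circle_deriv (eta_0 \<phi> (Phi \<phi> m))) (x $ i) \<noteq> 0)"

definition sign_vec :: "real ^ 'n \<Rightarrow> real ^ 'n"
  where "sign_vec a = (\<chi> i. sgn (a $ i))"

definition V_admissible ::
    "(circle \<Rightarrow> real) \<Rightarrow> real ^ 'n \<Rightarrow> circle ^ 'n \<Rightarrow> l2 \<Rightarrow> bool"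
  where "V_admissible \<phi> a x p \<longleftrightarrow>
    (\<forall>i. Phi_adj \<phi> p (x $ i) = sgn (a $ i) \<and> circle_deriv (Phi_adj \<phi> p) (x $ i) = 0)"

definition V_feasible :: "(circle \<Rightarrow> real) \<Rightarrow> real ^ 'n \<Rightarrow> circle ^ 'n \<Rightarrow> bool"
  where "V_feasible \<phi> a x \<longleftrightarrow> (\<exists>p. V_admissible \<phi> a x p)"

definition eta_V :: "(circle \<Rightarrow> real) \<Rightarrow> real ^ 'n \<Rightarrow> circle ^ 'n \<Rightarrow> circle \<Rightarrow> real"
  where "eta_V \<phi> a x = Phi_adj \<phi> (arg_min norm (V_admissible \<phi> a x))"

end

theory Submission
  imports Defs
begin

text \<open>Pairing \<open>y\<^sub>0\<close> with \<open>p\<close> gives \<open>\<Sum>\<^sub>i a\<^sub>i (\<Phi>\<^sup>*p)(x\<^sub>i)\<close>, which for \<open>\<bar>\<Phi>\<^sup>*p\<bar> \<le> 1\<close> is at most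
  \<open>\<Sum>\<^sub>i \<bar>a\<^sub>i\<bar>\<close>, with equality iff \<open>\<Phi>\<^sup>*p\<close> interpolates the signs; the \<open>x\<^sub>i\<close> are then extrema of
  \<open>\<Phi>\<^sup>*p\<close>, so \<open>p\<close> is admissible for (V). Hence, under the source condition, the solutions of the dual
  problem are the admissible \<open>p\<close> with \<open>\<bar>\<Phi>\<^sup>*p\<bar> \<le> 1\<close>. Both sets are closed and convex, so by completeness
  of \<open>L\<^sup>2\<close> each has a unique element of minimal norm, and assertion 1 follows. Admissibility means
  \<open>\<Gamma>\<^sup>*p = (sign a, 0)\<close>, and an admissible element of the range of \<open>\<Gamma>\<close> is orthogonal to all differences
  of admissible elements, which gives assertion 2. For assertion 3, if \<open>\<eta>\<^sub>0\<close> is nondegenerate and \<open>q\<close> is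
  admissible, then \<open>p\<^sub>0 + s (q - p\<^sub>0)\<close> still satisfies the sup norm bound for small \<open>s > 0\<close>, so
  \<open>\<parallel>p\<^sub>0\<parallel> \<le> \<parallel>q\<parallel>\<close> by convexity of the norm.\<close>

section \<open>Completeness of L2\<close>

lemma sq_int_l2_fun: "square_integrable (l2_fun p)"
  using Quotient3_l2 unfolding Quotient3_def l2_eq_def by blast

lemma abs_l2_l2_fun [simp]: "abs_l2 (l2_fun p) = p"
  using Quotient3_abs_rep[OF Quotient3_l2] .

lemma inner_abs_l2:
  assumes "square_integrable f" "square_integrable g"
  shows "inner (abs_l2 f) (abs_l2 g) = (\<integral>t. f t * g t \<partial>circle_measure)"
  using assms by (intro inner_l2.abs_eq) (simp_all add: l2_eq_def)

lemma inner_abs_l2_left: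
  assumes "square_integrable f"
  shows "inner (abs_l2 f) p = (\<integral>t. f t * l2_fun p t \<partial>circle_measure)"
  using inner_abs_l2[OF assms sq_int_l2_fun[of p]] by simp

lemma norm_abs_l2:
  assumes "square_integrable f"
  shows "(norm (abs_l2 f))\<^sup>2 = (\<integral>t. (f t)\<^sup>2 \<partial>circle_measure)"
  unfolding power2_norm_eq_inner inner_abs_l2[OF assms assms] by (simp add: power2_eq_square)

lemma abs_l2_diff:
  assumes "square_integrable f" "square_integrable g"
  shows "abs_l2 (\<lambda>t. f t - g t) = abs_l2 f - abs_l2 g"
  using assms by (intro minus_l2.abs_eq[symmetric]) (simp_all add: l2_eq_def)

text \<open>Cauchy-Schwarz against the constant function 1, whose norm is 1 because the circle has
  total mass 1. This turns Cauchy sequences of L2 into Cauchy sequences of L1.\<close>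

lemma integral_abs_le_norm:
  assumes f: "square_integrable f"
  shows "integrable circle_measure f" "(\<integral>t. \<bar>f t\<bar> \<partial>circle_measure) \<le> norm (abs_l2 f)"
proof -
  have one: "square_integrable (\<lambda>t. 1)"
    by (simp add: continuous_imp_square_integrable)
  have f': "square_integrable (\<lambda>t. \<bar>f t\<bar>)"
    using f by (auto simp: square_integrable_def)
  show "integrable circle_measure f"
    using square_integrable_mult[OF f one] by simp
  have "measure circle_measure UNIV = 1"
    by (simp add: measure_def emeasure_circle_measure_UNIV)
  then have "norm (abs_l2 (\<lambda>t. 1)) = 1"
    using norm_abs_l2[OF one] norm_ge_zero[of "abs_l2 (\<lambda>t. 1)"]
    by (auto simp: circle_measure_def power2_eq_1_iff simp del: norm_ge_zero)
  moreover have "(norm (abs_l2 (\<lambda>t. \<bar>f t\<bar>)))\<^sup>2 = (norm (abs_l2 f))\<^sup>2"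
    unfolding norm_abs_l2[OF f'] norm_abs_l2[OF f] by simp
  ultimately show "(\<integral>t. \<bar>f t\<bar> \<partial>circle_measure) \<le> norm (abs_l2 f)"
    using norm_cauchy_schwarz[of "abs_l2 (\<lambda>t. \<bar>f t\<bar>)" "abs_l2 (\<lambda>t. 1)"] inner_abs_l2[OF f' one]
    by simp
qed

text \<open>Riesz-Fischer: an L2-Cauchy sequence is L1-Cauchy, so a subsequence converges almost
  everywhere. Fatou's lemma makes the pointwise limit an L2 limit of that subsequence, and a Cauchy
  sequence with a convergent subsequence converges.\<close>

instance l2 :: complete_space
proof
  fix X :: "nat \<Rightarrow> l2" assume X: "Cauchy X"
  define f where "f n = l2_fun (X n)" for n
  have f: "square_integrable (f n)" for n unfolding f_def by (rule sq_int_l2_fun)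
  have X_f: "X n = abs_l2 (f n)" for n by (simp add: f_def)
  have [measurable]: "f n \<in> borel_measurable borel" for n using f by (simp add: square_integrable_def)
  have dist_f: "dist (X m) (X n) = norm (abs_l2 (\<lambda>t. f m t - f n t))" for m n
    by (simp add: X_f abs_l2_diff[OF f f] dist_norm)
  have L1: "\<exists>N. \<forall>i\<ge>N. \<forall>j\<ge>N. (\<integral>t. norm (f i t - f j t) \<partial>circle_measure) < e" if e: "e > 0" for e
  proof -
    obtain N where N: "\<And>i j. i \<ge> N \<Longrightarrow> j \<ge> N \<Longrightarrow> dist (X i) (X j) < e"
      using metric_CauchyD[OF X e] by blast
    have "(\<integral>t. norm (f i t - f j t) \<partial>circle_measure) < e" if "i \<ge> N" "j \<ge> N" for i j
      using integral_abs_le_norm(2)[OF square_integrable_diff[OF f f]] N[OF that]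
      unfolding dist_f real_norm_def by (rule le_less_trans)
    then show ?thesis by blast
  qed
  obtain r where r: "strict_mono r" "AE t in circle_measure. Cauchy (\<lambda>i. f (r i) t)"
    by (rule cauchy_L1_AE_cauchy_subseq[where s = f, OF integral_abs_le_norm(1)[OF f] L1])
  \<comment> \<open>\<open>lim\<close> has some value even where the sequence diverges, so
    \<open>F\<close> is Borel on the whole circle, as \<open>square_integrable\<close>
    demands.\<close>
  define F where "F t = lim (\<lambda>i. f (r i) t)" for t
  have F_lim: "AE t in circle_measure. (\<lambda>i. f (r i) t) \<longlonglongrightarrow> F t"
    using r(2) unfolding F_def Cauchy_convergent_iff convergent_LIMSEQ_iff .
  have F_meas [measurable]: "F \<in> borel_measurable borel"
    unfolding F_def by measurable
  have key: "\<exists>N. \<forall>n\<ge>N. (\<integral>\<^sup>+t. ennreal ((F t - f (r n) t)\<^sup>2) \<partial>circle_measure) \<le> ennreal (e\<^sup>2)"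
    if e: "e > 0" for e
  proof -
    obtain N where N: "\<And>i j. i \<ge> N \<Longrightarrow> j \<ge> N \<Longrightarrow> dist (X i) (X j) < e"
      using metric_CauchyD[OF X e] by blast
    have "(\<integral>\<^sup>+t. ennreal ((F t - f (r n) t)\<^sup>2) \<partial>circle_measure) \<le> ennreal (e\<^sup>2)" if n: "n \<ge> N" for n
    proof -
      have "(\<integral>\<^sup>+t. ennreal ((F t - f (r n) t)\<^sup>2) \<partial>circle_measure)
          = (\<integral>\<^sup>+t. liminf (\<lambda>k. ennreal ((f (r k) t - f (r n) t)\<^sup>2)) \<partial>circle_measure)"
      proof (rule nn_integral_cong_AE)
        show "AE t in circle_measure. ennreal ((F t - f (r n) t)\<^sup>2) = liminf (\<lambda>k. ennreal ((f (r k) t - f (r n) t)\<^sup>2))"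
          using F_lim
        proof eventually_elim
          case (elim t)
          then have "(\<lambda>k. ennreal ((f (r k) t - f (r n) t)\<^sup>2)) \<longlonglongrightarrow> ennreal ((F t - f (r n) t)\<^sup>2)"
            by (intro tendsto_ennrealI tendsto_intros)
          then show ?case by (rule lim_imp_Liminf[OF sequentially_bot, symmetric])
        qed
      qed
      \<comment> \<open>Fatou's lemma, with \<open>n\<close> fixed and \<open>k\<close> running
        along the subsequence.\<close>
      also have "\<dots> \<le> liminf (\<lambda>k. \<integral>\<^sup>+t. ennreal ((f (r k) t - f (r n) t)\<^sup>2) \<partial>circle_measure)"
        by (rule nn_integral_liminf) simp
      also have "\<dots> = liminf (\<lambda>k. ennreal ((dist (X (r k)) (X (r n)))\<^sup>2))"
      proof -
        have sq: "square_integrable (\<lambda>t. f (r k) t - f (r n) t)" for k by (intro square_integrable_diff f)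
        have "(\<integral>\<^sup>+t. ennreal ((f (r k) t - f (r n) t)\<^sup>2) \<partial>circle_measure) = ennreal ((dist (X (r k)) (X (r n)))\<^sup>2)" for k
          unfolding dist_f norm_abs_l2[OF sq]
          using sq[of k] by (intro nn_integral_eq_integral) (simp_all add: square_integrable_def)
        then show ?thesis by simp
      qed
      also have "\<dots> \<le> ennreal (e\<^sup>2)"
      proof -
        have "\<forall>\<^sub>F k in sequentially. ennreal ((dist (X (r k)) (X (r n)))\<^sup>2) \<le> ennreal (e\<^sup>2)"
          unfolding eventually_sequentially
        proof (intro exI allI impI)
          fix k assume "N \<le> k"
          then have "dist (X (r k)) (X (r n)) < e"
            using n seq_suble[OF r(1), of k] seq_suble[OF r(1), of n] by (intro N) simp_all
          then show "ennreal ((dist (X (r k)) (X (r n)))\<^sup>2) \<le> ennreal (e\<^sup>2)"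
            by (intro ennreal_leI power_mono) auto
        qed
        then have "liminf (\<lambda>k. ennreal ((dist (X (r k)) (X (r n)))\<^sup>2)) \<le> liminf (\<lambda>k::nat. ennreal (e\<^sup>2))"
          by (rule Liminf_mono)
        then show ?thesis by (simp add: Liminf_const)
      qed
      finally show ?thesis .
    qed
    then show ?thesis by blast
  qed
  have sq_diff: "\<forall>\<^sub>F n in sequentially. square_integrable (\<lambda>t. F t - f (r n) t) \<and> norm (abs_l2 (\<lambda>t. F t - f (r n) t)) \<le> e"
    if e: "e > 0" for e
  proof -
    obtain N where N: "\<And>n. n \<ge> N \<Longrightarrow> (\<integral>\<^sup>+t. ennreal ((F t - f (r n) t)\<^sup>2) \<partial>circle_measure) \<le> ennreal (e\<^sup>2)"
      using key[OF e] by blast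
    show ?thesis unfolding eventually_sequentially
    proof (intro exI allI impI)
      fix n assume n: "N \<le> n"
      have int: "integrable circle_measure (\<lambda>t. (F t - f (r n) t)\<^sup>2)"
        by (intro integrableI_nonneg) (simp_all add: le_less_trans[OF N[OF n]])
      then have sq: "square_integrable (\<lambda>t. F t - f (r n) t)"
        by (simp add: square_integrable_def)
      have "(\<integral>t. (F t - f (r n) t)\<^sup>2 \<partial>circle_measure) \<le> e\<^sup>2"
        using N[OF n] nn_integral_eq_integral[OF int] by simp
      then have "norm (abs_l2 (\<lambda>t. F t - f (r n) t)) \<le> e"
        unfolding norm_abs_l2[OF sq, symmetric] by (rule power2_le_imp_le) (use e in simp)
      with sq show "square_integrable (\<lambda>t. F t - f (r n) t) \<and> norm (abs_l2 (\<lambda>t. F t - f (r n) t)) \<le> e" by simp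
    qed
  qed
  \<comment> \<open>One square integrable difference \<open>F - f (r n0)\<close> suffices to place
    \<open>F\<close> itself in L2.\<close>
  obtain n0 where "square_integrable (\<lambda>t. F t - f (r n0) t)"
    using sq_diff[of 1] by (auto simp: eventually_sequentially)
  from square_integrable_add[OF this f[of "r n0"]] have F: "square_integrable F" by simp
  have "(X \<circ> r) \<longlonglongrightarrow> abs_l2 F"
    unfolding tendsto_iff
  proof (intro allI impI)
    fix e :: real assume "e > 0"
    then have "\<forall>\<^sub>F n in sequentially. norm (abs_l2 (\<lambda>t. F t - f (r n) t)) \<le> e / 2"
      using sq_diff[of "e/2"] by (simp add: eventually_conj_iff)
    then show "\<forall>\<^sub>F n in sequentially. dist ((X \<circ> r) n) (abs_l2 F) < e"
      by eventually_elim
        (use \<open>e > 0\<close> in \<open>simp add: X_f dist_norm abs_l2_diff[OF F f] norm_minus_commute\<close>)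
  qed
  then show "convergent X"
    using Cauchy_converges_subseq[OF X r(1)] by (auto simp: convergent_def)
qed

section \<open>Minimal norm elements of closed convex sets\<close>

text \<open>Written with the midpoint, which stays in any convex set containing \<open>p\<close> and
  \<open>q\<close>: if both are nearly minimal in norm, the right side is nearly 0.\<close>

lemma parallelogram_law:
  fixes p q :: "'a::real_inner"
  shows "(norm (p - q))\<^sup>2 = 2 * (norm p)\<^sup>2 + 2 * (norm q)\<^sup>2 - 4 * (norm ((1/2) *\<^sub>R (p + q)))\<^sup>2"
  unfolding power2_norm_eq_inner
  by (simp add: inner_diff_left inner_diff_right inner_add_left inner_add_right inner_commute field_simps)

lemma convex_midpoint:
  assumes "convex K" "p \<in> K" "q \<in> K"
  shows "(1/2) *\<^sub>R (p + q) \<in> K"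
  using convexD[OF assms, of "1/2" "1/2"] by (simp add: scaleR_add_right)

text \<open>The midpoint is at least as long as \<open>p\<close>, so the parallelogram law forces
  \<open>p - q\<close> to vanish.\<close>

lemma min_norm_unique:
  fixes K :: "'a::real_inner set"
  assumes K: "convex K" "p \<in> K" "q \<in> K"
    and min: "\<And>r. r \<in> K \<Longrightarrow> norm p \<le> norm r" "norm q \<le> norm p"
  shows "q = p"
proof -
  have "norm p \<le> norm ((1/2) *\<^sub>R (p + q))"
    using min(1) convex_midpoint[OF K] .
  then have "(norm p)\<^sup>2 \<le> (norm ((1/2) *\<^sub>R (p + q)))\<^sup>2" "(norm q)\<^sup>2 \<le> (norm p)\<^sup>2"
    using min(2) by (simp_all add: power_mono)
  with parallelogram_law[of p q] have "(norm (p - q))\<^sup>2 \<le> 0" by linarith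
  then show ?thesis by simp
qed

text \<open>\<open>arg_min\<close> picks an arbitrary minimizer; by uniqueness it is any minimizer
  that can be exhibited.\<close>

lemma arg_min_norm_eq:
  fixes P :: "'a::real_inner \<Rightarrow> bool"
  assumes "convex {p. P p}" "is_arg_min norm P p"
  shows "arg_min norm P = p"
proof -
  have "is_arg_min norm P (arg_min norm P)"
    unfolding arg_min_def by (rule someI) fact
  then show ?thesis
    using assms by (intro min_norm_unique[of "{p. P p}"]) (auto simp: is_arg_min_linorder)
qed

text \<open>A minimizing sequence is Cauchy by the parallelogram law; its limit exists by
  completeness and lies in \<open>K\<close> by closedness.\<close>

lemma is_arg_min_norm_exists:
  fixes K :: "'a::{real_inner,complete_space} set"
  assumes "closed K" "convex K" "K \<noteq> {}"
  shows "\<exists>p. is_arg_min norm (\<lambda>p. p \<in> K) p"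
proof -
  define d where "d = Inf (norm ` K)"
  have bdd: "bdd_below (norm ` K)" by (rule bdd_belowI[of _ 0]) auto
  have d: "d \<le> norm p" if "p \<in> K" for p
    unfolding d_def using bdd that by (intro cInf_lower) auto
  have d0: "0 \<le> d" unfolding d_def using assms(3) by (intro cInf_greatest) auto
  have "\<exists>p\<in>K. norm p < d + 1 / Suc n" for n
  proof -
    have "Inf (norm ` K) < d + 1 / Suc n" unfolding d_def by simp
    then show ?thesis using assms(3) by (subst (asm) cInf_less_iff[OF _ bdd]) auto
  qed
  then obtain X where X: "\<And>n. X n \<in> K" "\<And>n. norm (X n) < d + 1 / Suc n" by metis
  have lim: "(\<lambda>n. norm (X n)) \<longlonglongrightarrow> d"
  proof (rule tendsto_sandwich)
    show "(\<lambda>n. d) \<longlonglongrightarrow> d" by simp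
    show "(\<lambda>n. d + 1 / Suc n) \<longlonglongrightarrow> d" using LIMSEQ_inverse_real_of_nat_add[of d] by (simp add: inverse_eq_divide)
  qed (use d X in \<open>auto intro!: always_eventually less_imp_le\<close>)
  have "Cauchy X"
  proof (rule metric_CauchyI)
    fix e :: real assume e: "e > 0"
    have "(\<lambda>n. (norm (X n))\<^sup>2) \<longlonglongrightarrow> d\<^sup>2" using lim by (rule tendsto_power)
    \<comment> \<open>The slack \<open>e\<^sup>2 / 4\<close> enters the parallelogram law with total
      weight 4 and so adds up to \<open>e\<^sup>2\<close>.\<close>
    moreover have "d\<^sup>2 < d\<^sup>2 + e\<^sup>2 / 4" using e by simp
    ultimately have "\<forall>\<^sub>F n in sequentially. (norm (X n))\<^sup>2 < d\<^sup>2 + e\<^sup>2 / 4" by (rule order_tendstoD(2))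
    then obtain N where N: "\<And>n. n \<ge> N \<Longrightarrow> (norm (X n))\<^sup>2 < d\<^sup>2 + e\<^sup>2 / 4"
      by (auto simp: eventually_sequentially)
    have "dist (X m) (X n) < e" if "m \<ge> N" "n \<ge> N" for m n
    proof -
      have "d\<^sup>2 \<le> (norm ((1/2) *\<^sub>R (X m + X n)))\<^sup>2"
        using d0 by (intro power_mono d convex_midpoint assms X)
      then have "(norm (X m - X n))\<^sup>2 < e\<^sup>2"
        using parallelogram_law[of "X m" "X n"] N[OF that(1)] N[OF that(2)] by linarith
      then show ?thesis unfolding dist_norm using e by (simp add: power2_less_imp_less)
    qed
    then show "\<exists>M. \<forall>m\<ge>M. \<forall>n\<ge>M. dist (X m) (X n) < e" by blast
  qed
  then obtain p where p: "X \<longlonglongrightarrow> p" by (auto simp: Cauchy_convergent_iff convergent_def)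
  have "norm p = d" using tendsto_norm[OF p] lim by (rule LIMSEQ_unique)
  moreover have "p \<in> K" using assms(1) X(1) p by (auto simp: closed_sequential_limits)
  ultimately show ?thesis using d by (auto simp: is_arg_min_linorder)
qed

section \<open>Calculus on the circle\<close>

lemma circle_of_surj: obtains r where "t = circle_of r" "0 \<le> r" "r \<le> 1"
proof -
  have "t = circle_of (rep_circle t)"
    using Quotient3_abs_rep[OF Quotient3_circle] by simp
  also have "\<dots> = circle_of (frac (rep_circle t))"
    by (simp add: circle.abs_eq_iff frac_def)
  finally show ?thesis
    by (rule that) (auto intro: less_imp_le frac_lt_1)
qed

lemma circle_of_plus: "circle_of r + circle_of s = circle_of (r + s)"
  by (rule plus_circle.abs_eq)

lemma circle_of_diff: "circle_of r - circle_of s = circle_of (r - s)"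
  by (rule minus_circle.abs_eq)

lemma circle_of_0: "circle_of 0 = 0"
  by (simp add: zero_circle_def)

text \<open>The universal property of the quotient topology; it moves continuity questions to the
  real line.\<close>

lemma continuous_on_circle_iff:
  fixes f :: "circle \<Rightarrow> 'a::topological_space"
  shows "continuous_on UNIV f \<longleftrightarrow> continuous_on UNIV (\<lambda>r. f (circle_of r))"
  by (simp add: continuous_on_open_vimage open_circle_def vimage_def)

lemma continuous_circle_lift:
  fixes f :: "circle \<Rightarrow> 'a::topological_space"
  assumes "continuous_on UNIV f"
  shows "continuous_on UNIV (\<lambda>r. f (t + circle_of r))"
proof -
  obtain s where t: "t = circle_of s" by (rule circle_of_surj)
  have "continuous_on UNIV (\<lambda>r. f (circle_of (s + r)))"
    using continuous_on_compose2[OF assms[unfolded continuous_on_circle_iff], of UNIV "\<lambda>r. s + r"]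
    by (simp add: continuous_on_add)
  then show ?thesis by (simp add: t circle_of_plus)
qed

lemma continuous_circle_reflect:
  fixes f :: "circle \<Rightarrow> 'a::topological_space"
  assumes "continuous_on UNIV f"
  shows "continuous_on UNIV (\<lambda>x. f (t - x))"
proof -
  obtain s where t: "t = circle_of s" by (rule circle_of_surj)
  have "continuous_on UNIV (\<lambda>r. f (circle_of (s - r)))"
    using continuous_on_compose2[OF assms[unfolded continuous_on_circle_iff], of UNIV "\<lambda>r. s - r"]
    by (simp add: continuous_on_diff)
  then show ?thesis by (simp add: t circle_of_diff continuous_on_circle_iff)
qed

lemma continuous_circle_shift:
  fixes f :: "circle \<Rightarrow> 'a::topological_space"
  assumes "continuous_on UNIV f"
  shows "continuous_on UNIV (\<lambda>x. f (x - t))"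
proof -
  obtain s where t: "t = circle_of s" by (rule circle_of_surj)
  have "continuous_on UNIV (\<lambda>r. f (circle_of (r - s)))"
    using continuous_on_compose2[OF assms[unfolded continuous_on_circle_iff], of UNIV "\<lambda>r. r - s"]
    by (simp add: continuous_on_diff)
  then show ?thesis by (simp add: t circle_of_diff continuous_on_circle_iff)
qed

lemma continuous_circle_bounded:
  fixes f :: "circle \<Rightarrow> real"
  assumes "continuous_on UNIV f"
  obtains B where "\<And>t. \<bar>f t\<bar> \<le> B"
proof -
  have "compact ((\<lambda>r. f (circle_of r)) ` {0..1})"
    using assms unfolding continuous_on_circle_iff
    by (intro compact_continuous_image compact_Icc) (rule continuous_on_subset, auto)
  then obtain B where B: "\<And>r. 0 \<le> r \<Longrightarrow> r \<le> 1 \<Longrightarrow> \<bar>f (circle_of r)\<bar> \<le> B"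
    by (fastforce dest!: compact_imp_bounded simp: bounded_iff)
  show ?thesis by (rule that[of B]) (metis B circle_of_surj)
qed

lemma sup_norm_le_iff:
  assumes "continuous_on UNIV f"
  shows "sup_norm f \<le> c \<longleftrightarrow> (\<forall>t. \<bar>f t\<bar> \<le> c)"
proof -
  obtain B where B: "\<And>t. \<bar>f t\<bar> \<le> B" by (rule continuous_circle_bounded[OF assms]) blast
  have "bdd_above (range (\<lambda>t. \<bar>f t\<bar>))" using B by (intro bdd_aboveI[of _ B]) auto
  then show ?thesis unfolding sup_norm_def by (subst cSUP_le_iff) auto
qed

text \<open>\<open>C1\<close> only speaks of derivatives at 0, but from every base point: moving the
  base point to \<open>t + circle_of r\<close> gives the derivative of the lift at
  \<open>r\<close>.\<close>

lemma C1_has_derivative: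
  assumes "C1 f"
  shows "((\<lambda>s. f (t + circle_of s)) has_real_derivative circle_deriv f (t + circle_of r)) (at r)"
proof -
  have "((\<lambda>s. f ((t + circle_of r) + circle_of s)) has_real_derivative circle_deriv f (t + circle_of r)) (at 0)"
    using assms unfolding C1_def circle_deriv_def by (simp add: DERIV_deriv_iff_real_differentiable)
  then have "((\<lambda>s. f (t + circle_of (r + s))) has_real_derivative circle_deriv f (t + circle_of r)) (at 0)"
    by (simp add: add.assoc circle_of_plus)
  then show ?thesis
    using DERIV_at_within_shift[of "\<lambda>s. f (t + circle_of s)" _ r 0 UNIV] by (simp add: add.commute)
qed

lemma circle_derivI:
  assumes "\<And>t. ((\<lambda>s. f (t + circle_of s)) has_real_derivative g t) (at 0)"
  shows "circle_deriv f = g"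
  using assms by (auto simp: circle_deriv_def fun_eq_iff intro: DERIV_imp_deriv)

lemma C1I:
  assumes "\<And>t. ((\<lambda>s. f (t + circle_of s)) has_real_derivative g t) (at 0)" "continuous_on UNIV g"
  shows "C1 f"
  using assms circle_derivI[OF assms(1)]
  by (auto simp: C1_def real_differentiable_def)

lemma C1_imp_continuous:
  assumes "C1 f"
  shows "continuous_on UNIV f"
proof -
  have "continuous_on UNIV (\<lambda>s. f (0 + circle_of s))"
    using C1_has_derivative[OF assms, of 0]
    by (intro continuous_at_imp_continuous_on ballI DERIV_isCont) blast
  then show ?thesis by (simp add: continuous_on_circle_iff)
qed

text \<open>The mean value inequality for the lift; it supplies the bound on difference quotients
  needed for dominated convergence.\<close>

lemma C1_lipschitz:
  assumes "C1 f" "\<And>t. \<bar>circle_deriv f t\<bar> \<le> B"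
  shows "\<bar>f (t + circle_of s) - f t\<bar> \<le> B * \<bar>s\<bar>"
proof -
  have "norm (f (t + circle_of s) - f (t + circle_of 0)) \<le> B * norm (s - 0)"
    using assms(2) by (intro field_differentiable_bound[OF convex_UNIV]) (auto intro: C1_has_derivative[OF assms(1)])
  then show ?thesis by (simp add: circle_of_0)
qed

section \<open>Regularity of \<open>Phi_adj \<phi> p\<close>\<close>

lemma continuous_circle_mult_l2_integrable:
  assumes "continuous_on UNIV f"
  shows "integrable circle_measure (\<lambda>x. f x * l2_fun p x)"
  using assms by (intro square_integrable_mult continuous_imp_square_integrable sq_int_l2_fun)

lemma square_integrable_reflect:
  assumes "continuous_on UNIV f"
  shows "square_integrable (\<lambda>x. f (t - x))"
  using assms by (intro continuous_imp_square_integrable continuous_circle_reflect)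

lemma Phi_adj_eq_inner:
  assumes "continuous_on UNIV \<phi>"
  shows "Phi_adj \<phi> p t = inner (abs_l2 (\<lambda>x. \<phi> (t - x))) p"
  using inner_abs_l2_left[OF square_integrable_reflect[OF assms]] by (simp add: Phi_adj_def)

text \<open>Differentiation under the integral sign: along any sequence tending to 0 the difference
  quotients of \<open>\<phi>\<close> are bounded by a bound \<open>B\<close> of its derivative, so
  \<open>B * \<bar>l2_fun p x\<bar>\<close> dominates.\<close>

lemma Phi_adj_has_derivative:
  assumes "C1 \<phi>"
  shows "((\<lambda>s. Phi_adj \<phi> p (t + circle_of s)) has_real_derivative Phi_adj (circle_deriv \<phi>) p t) (at 0)"
proof -
  have cont: "continuous_on UNIV \<phi>" "continuous_on UNIV (circle_deriv \<phi>)"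
    using assms C1_imp_continuous by (auto simp: C1_def)
  obtain B where B: "\<And>t. \<bar>circle_deriv \<phi> t\<bar> \<le> B" by (rule continuous_circle_bounded[OF cont(2)]) blast
  have p: "square_integrable (l2_fun p)" by (rule sq_int_l2_fun)
  have [measurable]: "l2_fun p \<in> borel_measurable borel" using p by (simp add: square_integrable_def)
  have [measurable]: "(\<lambda>x. \<phi> (t - x)) \<in> borel_measurable borel" "(\<lambda>x. circle_deriv \<phi> (t - x)) \<in> borel_measurable borel" for t
    by (intro borel_measurable_continuous_onI continuous_circle_reflect cont)+
  have "(\<lambda>h. (Phi_adj \<phi> p (t + circle_of h) - Phi_adj \<phi> p t) / h) \<midarrow>0\<rightarrow> Phi_adj (circle_deriv \<phi>) p t"
    unfolding tendsto_at_iff_sequentially comp_def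
  proof (intro allI impI)
    fix X :: "nat \<Rightarrow> real" assume X: "\<forall>i. X i \<in> UNIV - {0}" "X \<longlonglongrightarrow> 0"
    have *: "(Phi_adj \<phi> p (t + circle_of (X n)) - Phi_adj \<phi> p t) / X n
      = (\<integral>x. (\<phi> (t + circle_of (X n) - x) - \<phi> (t - x)) / X n * l2_fun p x \<partial>circle_measure)" for n
      unfolding Phi_adj_def
      using continuous_circle_mult_l2_integrable[OF continuous_circle_reflect[OF cont(1)]]
      by (simp add: diff_divide_distrib left_diff_distrib flip: Bochner_Integration.integral_diff
          Bochner_Integration.integral_divide_zero)
    show "(\<lambda>n. (Phi_adj \<phi> p (t + circle_of (X n)) - Phi_adj \<phi> p t) / X n) \<longlonglongrightarrow> Phi_adj (circle_deriv \<phi>) p t"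
      unfolding * unfolding Phi_adj_def
    proof (rule integral_dominated_convergence[where w="\<lambda>x. B * \<bar>l2_fun p x\<bar>"])
      \<comment> \<open>The constant kernel 1 in the product lemma yields integrability of
        \<open>l2_fun p\<close> itself.\<close>
      show "integrable circle_measure (\<lambda>x. B * \<bar>l2_fun p x\<bar>)"
        using continuous_circle_mult_l2_integrable[OF continuous_on_const[of _ 1], of p] by simp
      show "AE x in circle_measure. (\<lambda>n. (\<phi> (t + circle_of (X n) - x) - \<phi> (t - x)) / X n * l2_fun p x)
         \<longlonglongrightarrow> circle_deriv \<phi> (t - x) * l2_fun p x"
      proof (intro AE_I2 tendsto_mult tendsto_const)
        fix x
        have "(\<lambda>h. (\<phi> (t - x + circle_of h) - \<phi> (t - x)) / h) \<midarrow>0\<rightarrow> circle_deriv \<phi> (t - x)"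
          using C1_has_derivative[OF assms, of "t - x" 0] by (simp add: DERIV_def circle_of_0)
        then show "(\<lambda>n. (\<phi> (t + circle_of (X n) - x) - \<phi> (t - x)) / X n) \<longlonglongrightarrow> circle_deriv \<phi> (t - x)"
          using X by (simp add: tendsto_at_iff_sequentially comp_def algebra_simps)
      qed
      show "AE x in circle_measure. norm ((\<phi> (t + circle_of (X n) - x) - \<phi> (t - x)) / X n * l2_fun p x) \<le> B * \<bar>l2_fun p x\<bar>" for n
      proof (intro AE_I2)
        fix x
        have "\<bar>\<phi> (t + circle_of (X n) - x) - \<phi> (t - x)\<bar> \<le> B * \<bar>X n\<bar>"
          using C1_lipschitz[OF assms B, of "t - x" "X n"] by (simp add: algebra_simps)
        then have "\<bar>(\<phi> (t + circle_of (X n) - x) - \<phi> (t - x)) / X n\<bar> \<le> B"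
          using X(1) by (simp add: pos_divide_le_eq)
        then show "norm ((\<phi> (t + circle_of (X n) - x) - \<phi> (t - x)) / X n * l2_fun p x) \<le> B * \<bar>l2_fun p x\<bar>"
          by (simp only: real_norm_def abs_mult mult_right_mono abs_ge_zero)
      qed
    qed measurable
  qed
  then show ?thesis by (simp add: DERIV_def circle_of_0)
qed

lemma continuous_Phi_adj:
  assumes "continuous_on UNIV \<phi>"
  shows "continuous_on UNIV (Phi_adj \<phi> p)"
  unfolding continuous_on_circle_iff[of "Phi_adj \<phi> p"]
proof (rule continuous_on_sequentiallyI)
  fix X :: "nat \<Rightarrow> real" and r assume X: "X \<longlonglongrightarrow> r"
  obtain B where B: "\<And>t. \<bar>\<phi> t\<bar> \<le> B" by (rule continuous_circle_bounded[OF assms]) blast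
  have [measurable]: "l2_fun p \<in> borel_measurable borel" using sq_int_l2_fun[of p] by (simp add: square_integrable_def)
  have [measurable]: "(\<lambda>x. \<phi> (t - x)) \<in> borel_measurable borel" for t
    by (intro borel_measurable_continuous_onI continuous_circle_reflect assms)
  show "(\<lambda>n. Phi_adj \<phi> p (circle_of (X n))) \<longlonglongrightarrow> Phi_adj \<phi> p (circle_of r)"
    unfolding Phi_adj_def
  proof (rule integral_dominated_convergence[where w="\<lambda>x. B * \<bar>l2_fun p x\<bar>"])
    show "integrable circle_measure (\<lambda>x. B * \<bar>l2_fun p x\<bar>)"
      using continuous_circle_mult_l2_integrable[OF continuous_on_const[of _ 1], of p] by simp
    show "AE x in circle_measure. (\<lambda>n. \<phi> (circle_of (X n) - x) * l2_fun p x) \<longlonglongrightarrow> \<phi> (circle_of r - x) * l2_fun p x"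
    proof (intro AE_I2 tendsto_mult tendsto_const)
      fix x
      have "continuous_on UNIV (\<lambda>s. \<phi> (circle_of s - x))"
        using continuous_circle_lift[OF assms, of "- x"] by simp
      then show "(\<lambda>n. \<phi> (circle_of (X n) - x)) \<longlonglongrightarrow> \<phi> (circle_of r - x)"
        using X by (auto intro: continuous_on_tendsto_compose)
    qed
    show "AE x in circle_measure. norm (\<phi> (circle_of (X n) - x) * l2_fun p x) \<le> B * \<bar>l2_fun p x\<bar>" for n
      using B by (auto simp: abs_mult intro!: mult_right_mono)
  qed measurable
qed

text \<open>Moving the derivative onto the kernel makes the derivative constraints of (V) linear in
  \<open>p\<close>, of the same form as the value constraints.\<close>

lemma circle_deriv_Phi_adj:
  assumes "C1 \<phi>"
  shows "circle_deriv (Phi_adj \<phi> p) = Phi_adj (circle_deriv \<phi>) p"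
  by (rule circle_derivI) (rule Phi_adj_has_derivative[OF assms])

lemma C1_Phi_adj:
  assumes "C1 \<phi>"
  shows "C1 (Phi_adj \<phi> p)"
  using assms by (intro C1I[OF Phi_adj_has_derivative[OF assms]] continuous_Phi_adj) (simp add: C1_def)

lemma C2_Phi_adj:
  assumes "C2 \<phi>"
  shows "C2 (Phi_adj \<phi> p)"
  using assms by (simp add: C2_def C1_Phi_adj circle_deriv_Phi_adj)

section \<open>Perturbation of nondegenerate certificates\<close>

text \<open>Taylor expansion with Peano remainder, from a second derivative at 0 alone:
  \<open>G' h - D * h\<close> is small relative to \<open>h\<close>, and the mean value inequality
  for \<open>G s - D / 2 * s\<^sup>2\<close> integrates this.\<close>

lemma peano_order2:
  fixes G :: "real \<Rightarrow> real"
  assumes G: "\<And>s. (G has_real_derivative G' s) (at s)"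
    and G': "(G' has_real_derivative D) (at 0)" "G' 0 = 0" and e: "0 < e"
  obtains d where "d > 0" "\<And>u. \<bar>u\<bar> < d \<Longrightarrow> \<bar>G u - G 0 - D / 2 * u\<^sup>2\<bar> \<le> e * u\<^sup>2"
proof -
  have "(\<lambda>h. G' h / h) \<midarrow>0\<rightarrow> D" using G' by (simp add: DERIV_def)
  then obtain d where d: "d > 0" "\<And>h. h \<noteq> 0 \<Longrightarrow> \<bar>h\<bar> < d \<Longrightarrow> \<bar>G' h / h - D\<bar> < e"
    using LIM_D[OF _ e, of "\<lambda>h. G' h / h" D 0] by auto
  have lin: "\<bar>G' h - D * h\<bar> \<le> e * \<bar>h\<bar>" if "\<bar>h\<bar> < d" for h
  proof (cases "h = 0")
    case False
    then have "\<bar>G' h - D * h\<bar> = \<bar>G' h / h - D\<bar> * \<bar>h\<bar>"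
      by (simp add: left_diff_distrib flip: abs_mult)
    also have "\<dots> \<le> e * \<bar>h\<bar>" using d(2)[OF False that] by (intro mult_right_mono) auto
    finally show ?thesis .
  qed (simp add: G')
  show ?thesis
  proof (rule that[OF d(1)])
    fix u assume u: "\<bar>u\<bar> < d"
    have "norm ((G u - D / 2 * u\<^sup>2) - (G 0 - D / 2 * 0\<^sup>2)) \<le> (e * \<bar>u\<bar>) * norm (u - 0)"
    proof (rule field_differentiable_bound[where S="closed_segment 0 u"])
      show "((\<lambda>s. G s - D / 2 * s\<^sup>2) has_field_derivative G' s - D * s) (at s within closed_segment 0 u)" for s
        by (rule has_field_derivative_at_within) (auto intro!: derivative_eq_intros G)
      fix s assume "s \<in> closed_segment 0 u"
      then have s: "\<bar>s\<bar> \<le> \<bar>u\<bar>" by (auto simp: closed_segment_eq_real_ivl split: if_splits)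
      show "norm (G' s - D * s) \<le> e * \<bar>u\<bar>"
        using order_trans[OF lin mult_left_mono[OF s, of e]] s u e by simp
    qed auto
    then show "\<bar>G u - G 0 - D / 2 * u\<^sup>2\<bar> \<le> e * u\<^sup>2"
      by (simp add: power2_eq_square mult.assoc algebra_simps)
  qed
qed

text \<open>At a nondegenerate maximum \<open>G\<close> falls below 1 quadratically, while
  \<open>H\<close> is at most quadratic in \<open>u\<close>; a small multiple of \<open>H\<close> is
  absorbed by this fall.\<close>

lemma peak_perturbation:
  fixes G H :: "real \<Rightarrow> real"
  assumes G: "\<And>s. (G has_real_derivative G' s) (at s)" "(G' has_real_derivative D) (at 0)"
    and H: "\<And>s. (H has_real_derivative H' s) (at s)" "(H' has_real_derivative E) (at 0)"
    and G0: "G 0 = 1" "G' 0 = 0" "D \<noteq> 0" "\<And>u. G u \<le> 1"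
    and H0: "H 0 = 0" "H' 0 = 0"
  obtains d b where "d > 0" "b > 0" "\<And>u s. \<bar>u\<bar> < d \<Longrightarrow> 0 \<le> s \<Longrightarrow> s \<le> b \<Longrightarrow> \<bar>G u + s * H u\<bar> \<le> 1"
proof -
  \<comment> \<open>The tolerance is half of the quadratic coefficient, so half of the curvature
    survives the remainder.\<close>
  obtain d1 where d1: "d1 > 0" "\<And>u. \<bar>u\<bar> < d1 \<Longrightarrow> \<bar>G u - 1 - D / 2 * u\<^sup>2\<bar> \<le> \<bar>D\<bar> / 4 * u\<^sup>2"
    using G0(3) by (rule_tac peano_order2[OF G G0(2), of "\<bar>D\<bar> / 4"]) (auto simp: G0(1))
  obtain d2 where d2: "d2 > 0" "\<And>u. \<bar>u\<bar> < d2 \<Longrightarrow> \<bar>H u - E / 2 * u\<^sup>2\<bar> \<le> 1 * u\<^sup>2"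
    by (rule peano_order2[OF H H0(2), of 1]) (auto simp: H0(1))
  \<comment> \<open>A positive \<open>D\<close> would lift \<open>G\<close> above its bound 1 at
    \<open>d1 / 2\<close>.\<close>
  have D: "D < 0"
  proof (rule ccontr)
    assume "\<not> D < 0"
    with G0(3) have D: "D > 0" by simp
    have "1 + D / 4 * (d1 / 2)\<^sup>2 \<le> G (d1 / 2)"
      using abs_le_D2[OF d1(2)[of "d1 / 2"]] d1(1) D by simp
    moreover have "D / 4 * (d1 / 2)\<^sup>2 > 0" using D d1(1) by simp
    ultimately show False using G0(4)[of "d1 / 2"] by linarith
  qed
  define C where "C = \<bar>E\<bar> / 2 + 1"
  have C: "C > 0" by (simp add: C_def)
  \<comment> \<open>The bound on \<open>s\<close> makes \<open>s * \<bar>H u\<bar>\<close> at most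
    \<open>- D / 4 * u\<^sup>2\<close>, exactly what \<open>G\<close> leaves below 1. The radii 1
    and \<open>2 / - D\<close> give \<open>- D * u\<^sup>2 \<le> 2\<close>, which keeps the sum
    above -1.\<close>
  show ?thesis
  proof (rule that[of "min (min d1 d2) (min 1 (2 / - D))" "- D / 4 / C"])
    show "min (min d1 d2) (min 1 (2 / - D)) > 0" "- D / 4 / C > 0"
      using D C d1(1) d2(1) by (auto intro: divide_neg_pos)
    fix u s assume u: "\<bar>u\<bar> < min (min d1 d2) (min 1 (2 / - D))" and s: "0 \<le> s" "s \<le> - D / 4 / C"
    have G_u: "\<bar>G u - 1 - D / 2 * u\<^sup>2\<bar> \<le> - D / 4 * u\<^sup>2" using d1(2)[of u] u D by simp
    have "\<bar>E / 2 * u\<^sup>2\<bar> = \<bar>E\<bar> / 2 * u\<^sup>2" by (simp add: abs_mult)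
    then have "\<bar>H u\<bar> \<le> C * u\<^sup>2" using d2(2)[of u] u by (simp add: C_def distrib_right)
    then have "s * \<bar>H u\<bar> \<le> (- D / 4 / C) * (C * u\<^sup>2)"
      using s C D by (intro mult_mono) auto
    then have sH: "\<bar>s * H u\<bar> \<le> - D / 4 * u\<^sup>2" using C s by (simp add: abs_mult)
    have "u\<^sup>2 \<le> \<bar>u\<bar>" using u mult_left_le[of "\<bar>u\<bar>" "\<bar>u\<bar>"] by (simp add: power2_eq_square)
    moreover have "- D * \<bar>u\<bar> \<le> 2" using u D by (simp add: field_simps)
    ultimately have "- D * u\<^sup>2 \<le> 2" using D mult_left_mono[of "u\<^sup>2" "\<bar>u\<bar>" "- D"] by linarith
    with G_u sH show "\<bar>G u + s * H u\<bar> \<le> 1" by (simp add: abs_le_iff field_simps)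
  qed
qed

lemma C2_has_derivatives:
  assumes "C2 f"
  shows "((\<lambda>s. f (t + circle_of s)) has_real_derivative circle_deriv f (t + circle_of r)) (at r)"
    "((\<lambda>s. circle_deriv f (t + circle_of s)) has_real_derivative circle_deriv (circle_deriv f) t) (at 0)"
  using assms C1_has_derivative[of f t] C1_has_derivative[of "circle_deriv f" t 0]
  by (auto simp: C2_def circle_of_0)

lemma C2_imp_continuous: "C2 f \<Longrightarrow> continuous_on UNIV f"
  by (simp add: C2_def C1_imp_continuous)

text \<open>Multiplying by \<open>f t\<close>, which is 1 or -1, turns a minimum with value -1 into
  a maximum with value 1.\<close>

lemma saturation_perturbation:
  assumes f: "C2 f" "\<And>t. \<bar>f t\<bar> \<le> 1" and h: "C2 h"
    and t: "\<bar>f t\<bar> = 1" "circle_deriv f t = 0" "circle_deriv (circle_deriv f) t \<noteq> 0"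
      "h t = 0" "circle_deriv h t = 0"
  obtains d b where "d > 0" "b > 0"
    "\<And>u s. \<bar>u\<bar> < d \<Longrightarrow> 0 \<le> s \<Longrightarrow> s \<le> b \<Longrightarrow> \<bar>f (t + circle_of u) + s * h (t + circle_of u)\<bar> \<le> 1"
proof -
  have sg: "f t * f t = 1" "f t \<noteq> 0" using t(1) by (auto simp: abs_if split: if_splits)
  obtain d b where db: "d > 0" "b > 0"
    "\<And>u s. \<bar>u\<bar> < d \<Longrightarrow> 0 \<le> s \<Longrightarrow> s \<le> b \<Longrightarrow>
      \<bar>f t * f (t + circle_of u) + s * (f t * h (t + circle_of u))\<bar> \<le> 1"
  proof (rule peak_perturbation)
    show "((\<lambda>s. f t * f (t + circle_of s)) has_real_derivative f t * circle_deriv f (t + circle_of s)) (at s)"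
      "((\<lambda>s. f t * h (t + circle_of s)) has_real_derivative f t * circle_deriv h (t + circle_of s)) (at s)" for s
      by (intro DERIV_cmult C2_has_derivatives f h)+
    show "((\<lambda>s. f t * circle_deriv f (t + circle_of s)) has_real_derivative f t * circle_deriv (circle_deriv f) t) (at 0)"
      "((\<lambda>s. f t * circle_deriv h (t + circle_of s)) has_real_derivative f t * circle_deriv (circle_deriv h) t) (at 0)"
      by (intro DERIV_cmult C2_has_derivatives f h)+
    show "f t * f (t + circle_of u) \<le> 1" for u
      using f(2)[of "t + circle_of u"] t(1) abs_ge_self[of "f t * f (t + circle_of u)"] by (simp add: abs_mult)
  qed (use sg t in \<open>auto simp: circle_of_0\<close>)
  have "\<bar>f t * f (t + circle_of u) + s * (f t * h (t + circle_of u))\<bar>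
      = \<bar>f t\<bar> * \<bar>f (t + circle_of u) + s * h (t + circle_of u)\<bar>" for u s
    by (simp add: algebra_simps flip: abs_mult)
  with db t(1) show ?thesis by (intro that[of d b]) simp_all
qed

text \<open>By continuity \<open>\<bar>f\<bar>\<close> stays away from 1 near \<open>t\<close>, and
  \<open>h\<close> is bounded.\<close>

lemma interior_perturbation:
  fixes f h :: "circle \<Rightarrow> real"
  assumes "continuous_on UNIV f" "continuous_on UNIV h" "\<bar>f t\<bar> < 1"
  obtains d b where "d > 0" "b > 0"
    "\<And>u s. \<bar>u\<bar> < d \<Longrightarrow> 0 \<le> s \<Longrightarrow> s \<le> b \<Longrightarrow> \<bar>f (t + circle_of u) + s * h (t + circle_of u)\<bar> \<le> 1"
proof -
  obtain B where B: "\<And>t. \<bar>h t\<bar> \<le> B" by (rule continuous_circle_bounded[OF assms(2)]) blast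
  then have B0: "B \<ge> 0" by (meson abs_ge_zero order_trans)
  \<comment> \<open>Half of the gap to 1 pays for the variation of \<open>f\<close>, the other half
    for the perturbation.\<close>
  define e where "e = (1 - \<bar>f t\<bar>) / 2"
  have e: "e > 0" using assms(3) by (simp add: e_def)
  have "isCont (\<lambda>s. f (t + circle_of s)) 0"
    using continuous_circle_lift[OF assms(1), of t] by (simp add: continuous_on_eq_continuous_at)
  then obtain d where d: "d > 0" "\<And>u. \<bar>u\<bar> < d \<Longrightarrow> \<bar>f (t + circle_of u) - f t\<bar> < e"
    using e unfolding continuous_at_eps_delta by (auto simp: dist_real_def circle_of_0)
  \<comment> \<open>Dividing by \<open>B + 1\<close> rather than \<open>B\<close> covers the case
    \<open>B = 0\<close>.\<close>
  show ?thesis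
  proof (rule that[of d "e / (B + 1)"])
    show "d > 0" "e / (B + 1) > 0" using d e B0 by auto
    fix u s assume u: "\<bar>u\<bar> < d" and s: "0 \<le> s" "s \<le> e / (B + 1)"
    have "\<bar>s * h (t + circle_of u)\<bar> \<le> e / (B + 1) * (B + 1)"
      unfolding abs_mult using s B[of "t + circle_of u"] B0 e by (intro mult_mono) auto
    then have "\<bar>s * h (t + circle_of u)\<bar> \<le> e" using B0 by simp
    moreover have "\<bar>f (t + circle_of u) + s * h (t + circle_of u)\<bar>
        \<le> (\<bar>f (t + circle_of u) - f t\<bar> + \<bar>f t\<bar>) + \<bar>s * h (t + circle_of u)\<bar>"
      by (intro order_trans[OF abs_triangle_ineq] add_right_mono) linarith
    moreover have "\<bar>f t\<bar> = 1 - 2 * e" by (simp add: e_def field_simps)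
    ultimately show "\<bar>f (t + circle_of u) + s * h (t + circle_of u)\<bar> \<le> 1"
      using d(2)[OF u] by simp
  qed
qed

text \<open>Compactness makes the local bounds uniform: if every \<open>s = 1 / Suc n\<close>
  failed, the points of failure would accumulate at some \<open>l\<close>, against the local bound
  around \<open>l\<close>, which holds for all small \<open>s\<close> at once.\<close>

lemma nondegenerate_perturbation:
  assumes f: "C2 f" "\<And>t. \<bar>f t\<bar> \<le> 1" and h: "C2 h"
    and sat: "\<And>t. \<bar>f t\<bar> = 1 \<Longrightarrow> circle_deriv f t = 0 \<and> circle_deriv (circle_deriv f) t \<noteq> 0
      \<and> h t = 0 \<and> circle_deriv h t = 0"
  obtains s where "0 < s" "s \<le> 1" "\<And>t. \<bar>f t + s * h t\<bar> \<le> 1"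
proof (rule ccontr)
  assume "\<not> thesis"
  then have neg: "\<exists>t. \<not> \<bar>f t + s * h t\<bar> \<le> 1" if "0 < s" "s \<le> 1" for s
    using that \<open>\<And>s. \<lbrakk>0 < s; s \<le> 1; \<And>t. \<bar>f t + s * h t\<bar> \<le> 1\<rbrakk> \<Longrightarrow> thesis\<close> by blast
  have "\<exists>r\<in>{0..1}. \<not> \<bar>f (circle_of r) + 1 / Suc n * h (circle_of r)\<bar> \<le> 1" for n
  proof -
    obtain t where t: "\<not> \<bar>f t + 1 / Suc n * h t\<bar> \<le> 1" using neg[of "1 / Suc n"] by auto
    obtain r where "t = circle_of r" "0 \<le> r" "r \<le> 1" by (rule circle_of_surj)
    with t show ?thesis by (intro bexI[of _ r]) auto
  qed
  then obtain X where X: "\<And>n. X n \<in> {0..1}"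
    "\<And>n. \<not> \<bar>f (circle_of (X n)) + 1 / Suc n * h (circle_of (X n))\<bar> \<le> 1" by metis
  obtain r l where l: "strict_mono r" "(X \<circ> r) \<longlonglongrightarrow> l"
    using compact_Icc[of 0 "1::real"] X(1) unfolding compact_def by blast
  obtain d b where db: "d > 0" "b > 0" "\<And>u s. \<bar>u\<bar> < d \<Longrightarrow> 0 \<le> s \<Longrightarrow> s \<le> b \<Longrightarrow>
      \<bar>f (circle_of l + circle_of u) + s * h (circle_of l + circle_of u)\<bar> \<le> 1"
  proof (cases "\<bar>f (circle_of l)\<bar> = 1")
    case True
    with sat[OF True] show ?thesis
      using saturation_perturbation[OF f h True] that by blast
  next
    case False
    then have "\<bar>f (circle_of l)\<bar> < 1" using f(2)[of "circle_of l"] by simp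
    then show ?thesis
      using interior_perturbation[OF C2_imp_continuous[OF f(1)] C2_imp_continuous[OF h]] that by blast
  qed
  have "\<forall>\<^sub>F n in sequentially. dist ((X \<circ> r) n) l < d" using l(2) db(1) by (rule tendstoD)
  moreover have "\<forall>\<^sub>F n in sequentially. 1 / Suc n < b"
    using order_tendstoD(2)[OF LIMSEQ_inverse_real_of_nat db(2)] by (simp add: inverse_eq_divide)
  ultimately have "\<forall>\<^sub>F n in sequentially. dist ((X \<circ> r) n) l < d \<and> 1 / Suc n < b" by (rule eventually_conj)
  then obtain n where n: "\<bar>X (r n) - l\<bar> < d" "1 / Suc n < b"
    by (auto simp: eventually_sequentially dist_real_def)
  \<comment> \<open>Along the subsequence the failing parameter is \<open>1 / Suc (r n)\<close>, and
    \<open>r n \<ge> n\<close> puts it below \<open>b\<close> too.\<close>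
  have "1 / Suc (r n) \<le> 1 / Suc n" using seq_suble[OF l(1), of n] by (intro divide_left_mono) auto
  with db(3)[OF n(1), of "1 / Suc (r n)"] n(2) X(2)[of "r n"] show False
    by (simp add: circle_of_plus)
qed

section \<open>Interpolation and saturation\<close>

text \<open>The function \<open>1 - cos (2 * pi * r)\<close> is 1-periodic, hence independent of the
  representative, and vanishes exactly at the integers.\<close>

lemma continuous_circle_vanishing:
  obtains d :: "circle \<Rightarrow> real" where "continuous_on UNIV d" "\<And>t. d t = 0 \<longleftrightarrow> t = 0"
proof -
  define d where "d t = 1 - cos (2 * pi * rep_circle t)" for t
  have d: "d (circle_of r) = 1 - cos (2 * pi * r)" for r
  proof -
    have "circle_of (rep_circle (circle_of r)) = circle_of r"
      using Quotient3_abs_rep[OF Quotient3_circle] .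
    then have "rep_circle (circle_of r) - r \<in> \<int>" by (simp add: circle.abs_eq_iff)
    then obtain n :: int where "rep_circle (circle_of r) - r = of_int n" by (rule Ints_cases)
    then have "rep_circle (circle_of r) = r + of_int n" by simp
    then have "2 * pi * rep_circle (circle_of r) = 2 * pi * r + of_int n * (2 * pi)"
      by (simp add: algebra_simps)
    then show ?thesis using cos.plus_of_int[of "2 * pi * r" n] by (simp add: d_def)
  qed
  have "d (circle_of r) = 0 \<longleftrightarrow> circle_of r = 0" for r
  proof -
    have "d (circle_of r) = 0 \<longleftrightarrow> (\<exists>n::int. r = of_int n)"
      unfolding d by (auto simp: cos_one_2pi_int)
    also have "\<dots> \<longleftrightarrow> r \<in> \<int>" by (auto elim: Ints_cases)
    also have "\<dots> \<longleftrightarrow> circle_of r = circle_of 0" by (simp add: circle.abs_eq_iff)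
    finally show ?thesis by (simp add: circle_of_0)
  qed
  then have "d t = 0 \<longleftrightarrow> t = 0" for t by (rule_tac circle_of_surj[of t]) simp
  moreover have "continuous_on UNIV d"
    unfolding continuous_on_circle_iff d by (intro continuous_intros)
  ultimately show ?thesis by (rule that[rotated])
qed

text \<open>Lagrange interpolation with \<open>d (t - x j)\<close> in the role of the linear
  factors, then truncation to [-1, 1], which leaves the prescribed values alone.\<close>

lemma circle_interpolation:
  fixes x :: "'n::finite \<Rightarrow> circle" and c :: "'n \<Rightarrow> real"
  assumes "inj x" "\<And>i. \<bar>c i\<bar> \<le> 1"
  obtains f where "continuous_on UNIV f" "\<And>t. \<bar>f t\<bar> \<le> 1" "\<And>i. f (x i) = c i"
proof -
  obtain d :: "circle \<Rightarrow> real" where d: "continuous_on UNIV d" "\<And>t. d t = 0 \<longleftrightarrow> t = 0"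
    by (rule continuous_circle_vanishing) blast
  define L where "L i t = (\<Prod>j\<in>-{i}. d (t - x j) / d (x i - x j))" for i t
  have L: "L i (x k) = (if i = k then 1 else 0)" for i k
  proof (cases "i = k")
    case True
    have "L i (x i) = 1" unfolding L_def
      using assms(1) by (intro prod.neutral) (auto simp: d(2) inj_eq)
    with True show ?thesis by simp
  next
    case False
    then have "L i (x k) = 0" unfolding L_def by (intro prod_zero bexI[of _ k]) (auto simp: d(2))
    with False show ?thesis by simp
  qed
  define f where "f t = max (- 1) (min 1 (\<Sum>i\<in>UNIV. c i * L i t))" for t
  have "continuous_on UNIV (L i)" for i
    unfolding L_def divide_inverse
    by (intro continuous_on_prod continuous_on_mult_right continuous_circle_shift[OF d(1)])
  then have "continuous_on UNIV f"
    unfolding f_def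
    by (intro continuous_on_max continuous_on_min continuous_on_sum continuous_on_mult_left continuous_on_const)
  moreover have "\<bar>f t\<bar> \<le> 1" for t by (auto simp: f_def)
  moreover have "f (x k) = c k" for k
  proof -
    have "(\<Sum>i\<in>UNIV. c i * L i (x k)) = (\<Sum>i\<in>UNIV. if i = k then c i else 0)"
      by (intro sum.cong) (auto simp: L)
    then show ?thesis using assms(2)[of k] by (simp add: f_def)
  qed
  ultimately show ?thesis by (rule that)
qed

lemma sum_mult_le_sum_abs:
  fixes a c :: "'i \<Rightarrow> real"
  assumes "\<And>i. i \<in> I \<Longrightarrow> \<bar>c i\<bar> \<le> 1"
  shows "(\<Sum>i\<in>I. a i * c i) \<le> (\<Sum>i\<in>I. \<bar>a i\<bar>)"
proof (rule sum_mono)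
  fix i assume "i \<in> I"
  then have "\<bar>a i\<bar> * \<bar>c i\<bar> \<le> \<bar>a i\<bar>" using assms by (intro mult_left_le) auto
  then show "a i * c i \<le> \<bar>a i\<bar>" using abs_ge_self[of "a i * c i"] by (simp add: abs_mult)
qed

text \<open>The defect is a sum of the nonnegative terms \<open>a i * (sgn (a i) - c i)\<close>, so
  it vanishes only if each of them does.\<close>

lemma sum_mult_eq_sum_abs_iff:
  fixes a c :: "'i::finite \<Rightarrow> real"
  assumes "\<And>i. \<bar>c i\<bar> \<le> 1" "\<And>i. a i \<noteq> 0"
  shows "(\<Sum>i\<in>UNIV. a i * c i) = (\<Sum>i\<in>UNIV. \<bar>a i\<bar>) \<longleftrightarrow> (\<forall>i. c i = sgn (a i))"
proof -
  have eq: "\<bar>a i\<bar> - a i * c i = a i * (sgn (a i) - c i)" for i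
    unfolding abs_sgn[of "a i"] by (rule right_diff_distrib[symmetric])
  \<comment> \<open>The inequality for sums, taken over the single index \<open>i\<close>.\<close>
  have nonneg: "0 \<le> a i * (sgn (a i) - c i)" for i
    using sum_mult_le_sum_abs[of "{i}" c a] assms(1) by (simp flip: eq)
  have "(\<Sum>i\<in>UNIV. a i * c i) = (\<Sum>i\<in>UNIV. \<bar>a i\<bar>) \<longleftrightarrow> (\<Sum>i\<in>UNIV. \<bar>a i\<bar> - a i * c i) = 0"
    unfolding sum_subtractf by linarith
  also have "\<dots> \<longleftrightarrow> (\<forall>i\<in>UNIV. a i * (sgn (a i) - c i) = 0)"
    unfolding eq by (rule sum_nonneg_eq_0_iff[OF finite nonneg])
  also have "\<dots> \<longleftrightarrow> (\<forall>i. c i = sgn (a i))" using assms(2) by auto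
  finally show ?thesis .
qed

text \<open>Fermat's rule for \<open>f t * f\<close>, which has a maximum at \<open>t\<close>
  whichever sign \<open>f t\<close> has.\<close>

lemma circle_deriv_saturated:
  assumes "C1 f" "\<And>t. \<bar>f t\<bar> \<le> 1" "\<bar>f t\<bar> = 1"
  shows "circle_deriv f t = 0"
proof -
  have "f t * circle_deriv f t = 0"
  proof (rule DERIV_local_max)
    show "((\<lambda>s. f t * f (t + circle_of s)) has_real_derivative f t * circle_deriv f t) (at 0)"
      using C1_has_derivative[OF assms(1), of t 0] by (intro DERIV_cmult) (simp add: circle_of_0)
    show "\<forall>s. \<bar>0 - s\<bar> < 1 \<longrightarrow> f t * f (t + circle_of s) \<le> f t * f (t + circle_of 0)"
    proof (intro allI impI)
      fix s
      have "\<bar>f t * f (t + circle_of s)\<bar> \<le> 1" using assms(2,3) by (simp add: abs_mult)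
      moreover have "f t * f t = 1" using assms(3) by (auto simp: abs_if split: if_splits)
      ultimately show "f t * f (t + circle_of s) \<le> f t * f (t + circle_of 0)"
        by (simp add: circle_of_0)
    qed
  qed simp
  then show ?thesis using assms(3) by auto
qed

lemma Phi_adj_add_scaleR:
  assumes "continuous_on UNIV \<phi>"
  shows "Phi_adj \<phi> (p + s *\<^sub>R q) t = Phi_adj \<phi> p t + s * Phi_adj \<phi> q t"
  unfolding Phi_adj_eq_inner[OF assms] by (simp add: inner_add_right)

lemma Phi_adj_diff:
  assumes "continuous_on UNIV \<phi>"
  shows "Phi_adj \<phi> (p - q) t = Phi_adj \<phi> p t - Phi_adj \<phi> q t"
  unfolding Phi_adj_eq_inner[OF assms] by (simp add: inner_diff_right)

section \<open>Certificates\<close>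

context
  fixes \<phi> :: "circle \<Rightarrow> real" and a :: "real ^ 'n" and x :: "circle ^ 'n" and m :: radon
  assumes C2_phi: "C2 \<phi>"
    and a: "\<And>i. a $ i \<noteq> 0"
    and x: "inj (($) x)"
    and m: "m = (\<Sum>i\<in>UNIV. (a $ i) *\<^sub>R dirac (x $ i))"
begin

section \<open>Pairings with the discrete measure and its total variation\<close>

lemma C1_phi: "C1 \<phi>" "C1 (circle_deriv \<phi>)"
  using C2_phi by (auto simp: C2_def)

lemmas cont_phi = C1_imp_continuous[OF C1_phi(1)] C1_imp_continuous[OF C1_phi(2)]

lemma radon_integral_m: "continuous_on UNIV f \<Longrightarrow> radon_integral m f = (\<Sum>i\<in>UNIV. a $ i * f (x $ i))"
  unfolding m by (intro radon_integral_discrete x borel_measurable_continuous_onI)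

text \<open>\<open>Phi \<phi> m\<close> is a finite combination of reflected translates of
  \<open>\<phi>\<close>, so sum and integral can be exchanged; this is adjointness of the two
  operators on \<open>m\<close>.\<close>

lemma inner_Phi: "inner (Phi \<phi> m) p = (\<Sum>i\<in>UNIV. a $ i * Phi_adj \<phi> p (x $ i))"
proof -
  have "continuous_on UNIV (\<lambda>t. \<Sum>i\<in>UNIV. a $ i * \<phi> (x $ i - t))"
    by (intro continuous_intros continuous_circle_reflect cont_phi)
  then have sq: "square_integrable (\<lambda>t. \<Sum>i\<in>UNIV. a $ i * \<phi> (x $ i - t))"
    by (rule continuous_imp_square_integrable)
  have "Phi \<phi> m = abs_l2 (\<lambda>t. \<Sum>i\<in>UNIV. a $ i * \<phi> (x $ i - t))"
    unfolding Phi_def by (simp add: radon_integral_m continuous_circle_shift cont_phi)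
  then have "inner (Phi \<phi> m) p = (\<integral>t. (\<Sum>i\<in>UNIV. a $ i * \<phi> (x $ i - t)) * l2_fun p t \<partial>circle_measure)"
    by (simp add: inner_abs_l2_left[OF sq])
  also have "\<dots> = (\<integral>t. (\<Sum>i\<in>UNIV. a $ i * (\<phi> (x $ i - t) * l2_fun p t)) \<partial>circle_measure)"
    by (simp add: sum_distrib_right mult.assoc)
  also have "\<dots> = (\<Sum>i\<in>UNIV. a $ i * Phi_adj \<phi> p (x $ i))"
    using continuous_circle_mult_l2_integrable[OF continuous_circle_reflect[OF cont_phi(1)]]
    by (simp add: Phi_adj_def Bochner_Integration.integral_sum)
  finally show ?thesis .
qed

text \<open>The supremum is attained at a continuous function interpolating the signs at the
  distinct nodes.\<close>

lemma tv_norm_m: "tv_norm m = (\<Sum>i\<in>UNIV. \<bar>a $ i\<bar>)"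
  unfolding tv_norm_def
proof (rule cSup_eq_maximum)
  obtain f where f: "continuous_on UNIV f" "\<And>t. \<bar>f t\<bar> \<le> 1" "\<And>i. f (x $ i) = sgn (a $ i)"
    by (rule circle_interpolation[OF x, of "\<lambda>i. sgn (a $ i)"]) (auto simp: abs_sgn_eq)
  have "radon_integral m f = (\<Sum>i\<in>UNIV. \<bar>a $ i\<bar>)"
    unfolding radon_integral_m[OF f(1)]
    using f(2,3) by (intro iffD2[OF sum_mult_eq_sum_abs_iff] allI a) auto
  moreover have "sup_norm f \<le> 1" using f(2) by (simp add: sup_norm_le_iff[OF f(1)])
  ultimately show "(\<Sum>i\<in>UNIV. \<bar>a $ i\<bar>) \<in> {radon_integral m f |f. continuous_on UNIV f \<and> sup_norm f \<le> 1}"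
    using f(1) by (auto intro!: exI[of _ f])
next
  fix z assume "z \<in> {radon_integral m f |f. continuous_on UNIV f \<and> sup_norm f \<le> 1}"
  then obtain f where f: "z = radon_integral m f" "continuous_on UNIV f" "\<And>t. \<bar>f t\<bar> \<le> 1"
    by (auto simp: sup_norm_le_iff)
  then show "z \<le> (\<Sum>i\<in>UNIV. \<bar>a $ i\<bar>)"
    by (auto simp: radon_integral_m intro!: sum_mult_le_sum_abs)
qed

lemma sup_norm_Phi_adj_le: "sup_norm (Phi_adj \<phi> p) \<le> 1 \<longleftrightarrow> (\<forall>t. \<bar>Phi_adj \<phi> p t\<bar> \<le> 1)"
  by (intro sup_norm_le_iff continuous_Phi_adj cont_phi)

section \<open>Admissibility, the source condition and the dual solutions\<close>

lemma V_admissible_iff: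
  "V_admissible \<phi> a x p \<longleftrightarrow>
    (\<forall>i. Phi_adj \<phi> p (x $ i) = sgn (a $ i) \<and> Phi_adj (circle_deriv \<phi>) p (x $ i) = 0)"
  by (simp add: V_admissible_def circle_deriv_Phi_adj C1_phi)

text \<open>Under the sup norm bound the nodes are extrema, so the derivative constraints follow
  from the value constraints.\<close>

lemma V_admissible_iff_interpolates:
  assumes "\<And>t. \<bar>Phi_adj \<phi> p t\<bar> \<le> 1"
  shows "V_admissible \<phi> a x p \<longleftrightarrow> (\<forall>i. Phi_adj \<phi> p (x $ i) = sgn (a $ i))"
proof -
  have "circle_deriv (Phi_adj \<phi> p) (x $ i) = 0" if "Phi_adj \<phi> p (x $ i) = sgn (a $ i)" for i
    using that a[of i] by (intro circle_deriv_saturated C1_Phi_adj C1_phi assms) (auto simp: abs_sgn_eq)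
  then show ?thesis by (auto simp: V_admissible_def)
qed

text \<open>Attaining the total variation is the equality case of the bound by
  \<open>\<Sum>i\<in>UNIV. \<bar>a $ i\<bar>\<close>, that is, interpolation of the signs.\<close>

lemma source_condition_iff:
  "source_condition \<phi> m \<longleftrightarrow> (\<exists>p. V_admissible \<phi> a x p \<and> sup_norm (Phi_adj \<phi> p) \<le> 1)"
proof -
  have "Phi_adj \<phi> p \<in> tv_subdiff m \<longleftrightarrow> V_admissible \<phi> a x p \<and> sup_norm (Phi_adj \<phi> p) \<le> 1" for p
    unfolding tv_subdiff_def
    using V_admissible_iff_interpolates[of p]
      sum_mult_eq_sum_abs_iff[of "\<lambda>i. Phi_adj \<phi> p (x $ i)" "($) a"] a continuous_Phi_adj[OF cont_phi(1), of p]
    by (auto simp: radon_integral_m tv_norm_m sup_norm_Phi_adj_le)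
  then show ?thesis by (simp add: source_condition_def)
qed

text \<open>The source condition provides a competitor reaching the upper bound \<open>?T\<close>;
  the optimal value is therefore \<open>?T\<close>, and the solutions are the equality
  cases.\<close>

lemma dual_solution_iff:
  assumes "source_condition \<phi> m"
  shows "dual_solution \<phi> (Phi \<phi> m) p \<longleftrightarrow> V_admissible \<phi> a x p \<and> sup_norm (Phi_adj \<phi> p) \<le> 1"
proof -
  let ?T = "\<Sum>i\<in>UNIV. \<bar>a $ i\<bar>"
  have le: "inner (Phi \<phi> m) q \<le> ?T" if "sup_norm (Phi_adj \<phi> q) \<le> 1" for q
    unfolding inner_Phi using that by (intro sum_mult_le_sum_abs) (simp add: sup_norm_Phi_adj_le)
  have eq: "inner (Phi \<phi> m) q = ?T \<longleftrightarrow> V_admissible \<phi> a x q" if "sup_norm (Phi_adj \<phi> q) \<le> 1" for q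
    using that V_admissible_iff_interpolates[of q]
      sum_mult_eq_sum_abs_iff[of "\<lambda>i. Phi_adj \<phi> q (x $ i)" "($) a"] a
    by (simp add: inner_Phi sup_norm_Phi_adj_le)
  obtain q where "V_admissible \<phi> a x q" "sup_norm (Phi_adj \<phi> q) \<le> 1"
    using assms by (auto simp: source_condition_iff)
  with eq[of q] have q: "inner (Phi \<phi> m) q = ?T" "sup_norm (Phi_adj \<phi> q) \<le> 1" by auto
  have "dual_solution \<phi> (Phi \<phi> m) p \<longleftrightarrow> sup_norm (Phi_adj \<phi> p) \<le> 1 \<and> inner (Phi \<phi> m) p = ?T"
  proof
    assume "dual_solution \<phi> (Phi \<phi> m) p"
    then have "sup_norm (Phi_adj \<phi> p) \<le> 1" "?T \<le> inner (Phi \<phi> m) p"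
      using q by (auto simp: dual_solution_def is_arg_max_linorder)
    then show "sup_norm (Phi_adj \<phi> p) \<le> 1 \<and> inner (Phi \<phi> m) p = ?T" using le[of p] by simp
  next
    assume "sup_norm (Phi_adj \<phi> p) \<le> 1 \<and> inner (Phi \<phi> m) p = ?T"
    then show "dual_solution \<phi> (Phi \<phi> m) p"
      using le by (simp add: dual_solution_def is_arg_max_linorder)
  qed
  then show ?thesis using eq by blast
qed

section \<open>Existence of the minimal norm solutions\<close>

text \<open>Values and derivatives of \<open>Phi_adj \<phi> p\<close> at a point are inner products
  of \<open>p\<close> with fixed elements, so the constraints cut out closed hyperplanes.\<close>

lemma closed_convex_V_admissible:
  "closed {p. V_admissible \<phi> a x p}" "convex {p. V_admissible \<phi> a x p}"
proof -
  have "{p. V_admissible \<phi> a x p} =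
      (\<Inter>i. {p. inner (abs_l2 (\<lambda>t. \<phi> (x $ i - t))) p = sgn (a $ i)} \<inter>
        {p. inner (abs_l2 (\<lambda>t. circle_deriv \<phi> (x $ i - t))) p = 0})"
    by (auto simp: V_admissible_iff Phi_adj_eq_inner cont_phi)
  then show "closed {p. V_admissible \<phi> a x p}" "convex {p. V_admissible \<phi> a x p}"
    by (auto intro!: closed_INT convex_INT closed_Int convex_Int closed_hyperplane convex_hyperplane)
qed

text \<open>An intersection of closed half-spaces, two for each point of the circle.\<close>

lemma closed_convex_sup_norm_le:
  "closed {p. sup_norm (Phi_adj \<phi> p) \<le> 1}" "convex {p. sup_norm (Phi_adj \<phi> p) \<le> 1}"
proof -
  have "{p. sup_norm (Phi_adj \<phi> p) \<le> 1} = (\<Inter>t. {p. inner (abs_l2 (\<lambda>s. \<phi> (t - s))) p \<le> 1} \<inter>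
      {p. - 1 \<le> inner (abs_l2 (\<lambda>s. \<phi> (t - s))) p})"
    by (auto simp: sup_norm_Phi_adj_le Phi_adj_eq_inner cont_phi abs_le_iff minus_le_iff)
  then show "closed {p. sup_norm (Phi_adj \<phi> p) \<le> 1}" "convex {p. sup_norm (Phi_adj \<phi> p) \<le> 1}"
    by (auto intro!: closed_INT convex_INT closed_Int convex_Int closed_halfspace_le convex_halfspace_le
        closed_halfspace_ge convex_halfspace_ge)
qed

lemma closed_convex_dual_solution:
  assumes "source_condition \<phi> m"
  shows "closed {p. dual_solution \<phi> (Phi \<phi> m) p}" "convex {p. dual_solution \<phi> (Phi \<phi> m) p}"
proof -
  have "{p. dual_solution \<phi> (Phi \<phi> m) p} = {p. V_admissible \<phi> a x p} \<inter> {p. sup_norm (Phi_adj \<phi> p) \<le> 1}"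
    by (auto simp: dual_solution_iff[OF assms])
  then show "closed {p. dual_solution \<phi> (Phi \<phi> m) p}" "convex {p. dual_solution \<phi> (Phi \<phi> m) p}"
    by (simp_all add: closed_Int convex_Int closed_convex_V_admissible closed_convex_sup_norm_le)
qed

lemma p_V_is_arg_min:
  assumes "V_feasible \<phi> a x"
  shows "is_arg_min norm (V_admissible \<phi> a x) (arg_min norm (V_admissible \<phi> a x))"
  using is_arg_min_norm_exists[OF closed_convex_V_admissible] assms
  unfolding V_feasible_def arg_min_def by (auto intro: someI_ex)

lemma p_0_is_arg_min:
  assumes "source_condition \<phi> m"
  shows "is_arg_min norm (dual_solution \<phi> (Phi \<phi> m)) (arg_min norm (dual_solution \<phi> (Phi \<phi> m)))"
proof -
  have "{p. dual_solution \<phi> (Phi \<phi> m) p} \<noteq> {}"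
    using assms by (simp add: dual_solution_iff[OF assms] source_condition_iff)
  from is_arg_min_norm_exists[OF closed_convex_dual_solution[OF assms] this]
  show ?thesis unfolding arg_min_def by (auto intro: someI_ex)
qed

section \<open>Comparison of the two certificates\<close>

text \<open>The dual solutions are the admissible elements obeying the sup norm bound. A minimizer
  over all admissible elements that obeys the bound is also minimal among them; conversely
  \<open>eta_0\<close> always obeys it.\<close>

lemma eta_V_eq_eta_0_iff:
  "V_feasible \<phi> a x \<and> sup_norm (eta_V \<phi> a x) \<le> 1 \<longleftrightarrow>
    source_condition \<phi> m \<and> eta_V \<phi> a x = eta_0 \<phi> (Phi \<phi> m)"
proof (intro iffI conjI; elim conjE)
  let ?p = "arg_min norm (V_admissible \<phi> a x)"
  assume *: "V_feasible \<phi> a x" "sup_norm (eta_V \<phi> a x) \<le> 1"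
  have p: "V_admissible \<phi> a x ?p" "\<And>q. V_admissible \<phi> a x q \<Longrightarrow> norm ?p \<le> norm q" "sup_norm (Phi_adj \<phi> ?p) \<le> 1"
    using p_V_is_arg_min[OF *(1)] *(2) by (auto simp: is_arg_min_linorder eta_V_def)
  then show sc: "source_condition \<phi> m" by (auto simp: source_condition_iff)
  have "arg_min norm (dual_solution \<phi> (Phi \<phi> m)) = ?p"
    by (rule arg_min_norm_eq[OF closed_convex_dual_solution(2)[OF sc]])
      (use p in \<open>auto simp: is_arg_min_linorder dual_solution_iff[OF sc]\<close>)
  then show "eta_V \<phi> a x = eta_0 \<phi> (Phi \<phi> m)" by (simp add: eta_V_def eta_0_def)
next
  assume sc: "source_condition \<phi> m" and eq: "eta_V \<phi> a x = eta_0 \<phi> (Phi \<phi> m)"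
  from sc show "V_feasible \<phi> a x" by (auto simp: source_condition_iff V_feasible_def)
  show "sup_norm (eta_V \<phi> a x) \<le> 1"
    using p_0_is_arg_min[OF sc] by (simp add: eq eta_0_def is_arg_min_linorder dual_solution_iff[OF sc])
qed

section \<open>The operator \<open>Gamma_op\<close> and its pseudo-inverse\<close>

lemma inner_Gamma_op:
  "inner (Gamma_op \<phi> x w) p =
    inner w ((\<chi> i. Phi_adj \<phi> p (x $ i)), (\<chi> i. Phi_adj (circle_deriv \<phi>) p (x $ i)))"
  by (cases w) (simp add: Gamma_op_def inner_add_left inner_sum_left inner_prod_def inner_vec_def
      Phi_adj_eq_inner cont_phi)

text \<open>The adjoint lists the values and derivatives of \<open>Phi_adj \<phi> p\<close> at the
  nodes, so (V) is a minimal norm problem for one linear equation.\<close>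

lemma V_admissible_iff_adjoint:
  "V_admissible \<phi> a x p \<longleftrightarrow> adjoint (Gamma_op \<phi> x) p = (sign_vec a, 0)"
proof -
  have "adjoint (Gamma_op \<phi> x) p = ((\<chi> i. Phi_adj \<phi> p (x $ i)), (\<chi> i. Phi_adj (circle_deriv \<phi>) p (x $ i)))"
    by (rule iffD1[OF vector_eq_ldot])
      (simp add: inner_Gamma_op flip: inner_adjoint[OF linear_Gamma_op])
  then show ?thesis by (auto simp: V_admissible_iff sign_vec_def vec_eq_iff)
qed

text \<open>Full rank gives \<open>w\<close> with \<open>?G w\<close> admissible; among the
  solutions of a linear equation, one in the range of the adjoint operator has least norm.\<close>

lemma eta_V_eq_pinv:
  assumes "inj (Gamma_op \<phi> x)"
  shows "eta_V \<phi> a x = Phi_adj \<phi> (Gamma_pinv_adj \<phi> x (sign_vec a, 0))"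
proof -
  let ?G = "Gamma_op \<phi> x"
  define w where "w = inv (adjoint ?G \<circ> ?G) (sign_vec a, 0)"
  have "(adjoint ?G \<circ> ?G) w = (sign_vec a, 0)"
    unfolding w_def using assms[unfolded inj_Gamma_op_iff] by (rule surj_f_inv_f[OF bij_is_surj])
  then have w: "adjoint ?G (?G w) = (sign_vec a, 0)" by simp
  have "norm (?G w) \<le> norm p" if "V_admissible \<phi> a x p" for p
  proof -
    \<comment> \<open>Both sides equal the inner product of \<open>w\<close> with
      \<open>(sign_vec a, 0)\<close>.\<close>
    have "inner (?G w) (?G w) = inner (?G w) p"
      using that w by (simp add: inner_adjoint[OF linear_Gamma_op] V_admissible_iff_adjoint)
    then have "norm (?G w) * norm (?G w) \<le> norm (?G w) * norm p"
      using norm_cauchy_schwarz[of "?G w" p] by (simp add: dot_square_norm power2_eq_square)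
    then show ?thesis by (cases "?G w = 0") auto
  qed
  then have "arg_min norm (V_admissible \<phi> a x) = ?G w"
    using w by (intro arg_min_norm_eq closed_convex_V_admissible)
      (auto simp: is_arg_min_linorder V_admissible_iff_adjoint)
  then show ?thesis by (simp add: eta_V_def Gamma_pinv_adj_def w_def)
qed

section \<open>Nondegenerate certificates\<close>

text \<open>A local minimum of a convex function is global: \<open>p\<close> is minimal among
  bounded admissible elements, and nondegeneracy keeps the segment towards any admissible
  \<open>q\<close> bounded near \<open>p\<close>.\<close>

lemma eta_V_eq_eta_0_nondegenerate:
  assumes "nondegenerate_source_condition \<phi> m x"
  shows "eta_V \<phi> a x = eta_0 \<phi> (Phi \<phi> m)"
proof -
  define p where "p = arg_min norm (dual_solution \<phi> (Phi \<phi> m))"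
  have sc: "source_condition \<phi> m" and nd: "\<And>s. s \<notin> range (($) x) \<Longrightarrow> \<bar>Phi_adj \<phi> p s\<bar> < 1"
    "\<And>i. circle_deriv (circle_deriv (Phi_adj \<phi> p)) (x $ i) \<noteq> 0"
    using assms by (auto simp: nondegenerate_source_condition_def eta_0_def p_def)
  have p: "V_admissible \<phi> a x p" "\<And>t. \<bar>Phi_adj \<phi> p t\<bar> \<le> 1"
    and p_min: "\<And>q. V_admissible \<phi> a x q \<Longrightarrow> (\<And>t. \<bar>Phi_adj \<phi> q t\<bar> \<le> 1) \<Longrightarrow> norm p \<le> norm q"
    using p_0_is_arg_min[OF sc]
    by (auto simp: is_arg_min_linorder dual_solution_iff[OF sc] sup_norm_Phi_adj_le p_def)
  have "norm p \<le> norm q" if q: "V_admissible \<phi> a x q" for q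
  proof -
    \<comment> \<open>Saturation happens only at nodes, where \<open>p\<close> and \<open>q\<close>
      satisfy the same constraints, so their difference vanishes to first order.\<close>
    have sat: "circle_deriv (Phi_adj \<phi> p) t = 0 \<and> circle_deriv (circle_deriv (Phi_adj \<phi> p)) t \<noteq> 0 \<and>
        Phi_adj \<phi> (q - p) t = 0 \<and> circle_deriv (Phi_adj \<phi> (q - p)) t = 0"
      if t: "\<bar>Phi_adj \<phi> p t\<bar> = 1" for t
    proof -
      have "t \<in> range (($) x)" using t nd(1)[of t] by (rule_tac ccontr) simp
      then obtain i where "t = x $ i" by blast
      with p(1) q nd(2)[of i] show ?thesis
        by (simp add: V_admissible_iff Phi_adj_diff cont_phi circle_deriv_Phi_adj C1_phi)
    qed
    obtain s where s: "0 < s" "s \<le> 1" "\<And>t. \<bar>Phi_adj \<phi> p t + s * Phi_adj \<phi> (q - p) t\<bar> \<le> 1"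
      using nondegenerate_perturbation[OF C2_Phi_adj[OF C2_phi] p(2) C2_Phi_adj[OF C2_phi] sat] by blast
    \<comment> \<open>The convex combination form, to which the triangle inequality is
      applied.\<close>
    have eq: "p + s *\<^sub>R (q - p) = (1 - s) *\<^sub>R p + s *\<^sub>R q" by (simp add: algebra_simps)
    have "V_admissible \<phi> a x (p + s *\<^sub>R (q - p))"
      using p(1) q unfolding V_admissible_iff by (simp add: Phi_adj_add_scaleR Phi_adj_diff cont_phi)
    then have "norm p \<le> norm (p + s *\<^sub>R (q - p))"
      using s(3) by (intro p_min) (simp_all add: Phi_adj_add_scaleR cont_phi)
    also have "\<dots> \<le> (1 - s) * norm p + s * norm q"
      unfolding eq using s(1,2) by (intro order_trans[OF norm_triangle_ineq]) simp
    finally have "s * norm p \<le> s * norm q" by (simp add: algebra_simps)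
    then show ?thesis using s(1) by simp
  qed
  then have "arg_min norm (V_admissible \<phi> a x) = p"
    using p(1) by (intro arg_min_norm_eq closed_convex_V_admissible) (auto simp: is_arg_min_linorder)
  then show ?thesis by (simp add: eta_V_def eta_0_def p_def)
qed

text \<open>In the converse direction \<open>eta_V\<close> has modulus 1 at the nodes by
  interpolation and less elsewhere, so the sup norm bound holds and identifies it with
  \<open>eta_0\<close>.\<close>

lemma nondegenerate_iff_eta_V:
  "nondegenerate_source_condition \<phi> m x \<longleftrightarrow>
    V_feasible \<phi> a x \<and> (\<forall>s. s \<notin> range (($) x) \<longrightarrow> \<bar>eta_V \<phi> a x s\<bar> < 1) \<and>
    (\<forall>i. circle_deriv (circle_deriv (eta_V \<phi> a x)) (x $ i) \<noteq> 0)" (is "_ \<longleftrightarrow> ?R")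
proof
  assume nd: "nondegenerate_source_condition \<phi> m x"
  then have "source_condition \<phi> m" by (simp add: nondegenerate_source_condition_def)
  then have "V_feasible \<phi> a x" using eta_V_eq_eta_0_iff eta_V_eq_eta_0_nondegenerate[OF nd] by blast
  then show ?R using nd eta_V_eq_eta_0_nondegenerate[OF nd] by (simp add: nondegenerate_source_condition_def)
next
  assume R: ?R
  then have adm: "V_admissible \<phi> a x (arg_min norm (V_admissible \<phi> a x))"
    using p_V_is_arg_min by (simp add: is_arg_min_linorder)
  have "\<bar>eta_V \<phi> a x t\<bar> \<le> 1" for t
  proof (cases "t \<in> range (($) x)")
    case True
    then show ?thesis using adm by (auto simp: V_admissible_def eta_V_def abs_sgn_eq)
  next
    case False
    then show ?thesis using R by (simp add: less_imp_le)
  qed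
  then have "sup_norm (eta_V \<phi> a x) \<le> 1" by (simp add: eta_V_def sup_norm_Phi_adj_le)
  with R eta_V_eq_eta_0_iff show "nondegenerate_source_condition \<phi> m x"
    by (simp add: nondegenerate_source_condition_def)
qed

end

theorem proposition7:
  fixes \<phi> :: "circle \<Rightarrow> real"
    and a0 :: "real ^ 'n" and x0 :: "circle ^ 'n"
    and m0 :: radon and y0 :: l2
  assumes "C2 \<phi>"
    and "\<forall>i. a0 $ i \<noteq> 0"
    and "inj (($) x0)"
    and "m0 = (\<Sum>i\<in>UNIV. (a0 $ i) *\<^sub>R dirac (x0 $ i))"
    and "y0 = Phi \<phi> m0"
  shows
    "((V_feasible \<phi> a0 x0 \<and> sup_norm (eta_V \<phi> a0 x0) \<le> 1) \<longleftrightarrow>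
        (source_condition \<phi> m0 \<and> eta_V \<phi> a0 x0 = eta_0 \<phi> y0))
     \<and> (V_feasible \<phi> a0 x0 \<and> inj (Gamma_op \<phi> x0) \<longrightarrow>
        eta_V \<phi> a0 x0 = Phi_adj \<phi> (Gamma_pinv_adj \<phi> x0 (sign_vec a0, 0)))
     \<and> (inj (Gamma_op \<phi> x0) \<longrightarrow>
        (nondegenerate_source_condition \<phi> m0 x0 \<longleftrightarrow>
          V_feasible \<phi> a0 x0
          \<and> (\<forall>s. s \<notin> range (($) x0) \<longrightarrow> \<bar>eta_V \<phi> a0 x0 s\<bar> < 1)
          \<and> (\<forall>i. circle_deriv (circle_deriv (eta_V \<phi> a0 x0)) (x0 $ i) \<noteq> 0)))"
proof -
  note a0 = assms(2)[rule_format]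
  note * = assms(1) a0 assms(3,4)
  show ?thesis
    unfolding assms(5)
    using eta_V_eq_eta_0_iff[OF *] eta_V_eq_pinv[OF *] nondegenerate_iff_eta_V[OF *] by blast
qed

end
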